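(* The problem (MSSP) of matching siblings with same preferences to the same activities can be solved in polynomial time: there is an algorithm that, given an instance of (MSSP), decides in time polynomial in the size of the input whether the instance admits an activity-stable matching.
   Context: A school matching instance $I=(A,B,\succ,q)$ consists of a finite set $A$ of students, a finite set $B$ of schools, for each $a\in A$ a strict total order $\succ_a$ on $B^+=B\cup\{\emptyset\}$, for each $b\in B$ a strict total order $\succ_b$ on $A^+=A\cup\{\emptyset\}$ ($\emptyset$ is the outside option), and for each $b\in B$ a quota $q_b\in\mathbb N$, $q_b\le|A|$. A matching is a set of pairs $M\subset (A^+\times B^+)\setminus\{(\emptyset,\emptyset)\}$ in which every $a\in A$ is paired with exactly one element $M(a)\in B^+$, and every $b\in B$ is paired either with exactly $q_b$ students or with at most $q_b-1$ students and the outside option; $M(b)\subset A^+$ is the set of partners of $b$. $M$ is stable if there is no $ab\in A\times B$ with $b\succ_a M(a)$ and $a\succ_b a'$ for some $a'\in M(b)$, no $a\in A$ with $\emptyset\succ_a M(a)$, and no $b\in B$ with $\emptyset\succ_b a'$ for some $a'\in M(b)$. $\mathcal S(I)$ is the set of stable matchings of $I$. An instance of (MSSP) consists of a school matching instance $I=(A,B,\succ,q)$ (elements of $B$ are called classes), a set of sibling pairs $\mathcal C=\{(a_1,\bar a_1),\dots,(a_m,\bar a_m)\}\subseteq A\times A$ with $a_i\neq\bar a_i$, and a set of activities $\{c_1,\dots,c_k\}$, such that: (1) for every $j\in[k]$ there is a non-empty set $\{b_j^1,\dots,b_j^{\ell_j}\}\subseteq B$ of classes of activity $c_j$ (called same-activity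 classes), and these sets, $j\in[k]$, partition $B$; (2) for each activity $c_j$ and each student $a$ there is exactly one class $b_j^a\in\{b_j^1,\dots,b_j^{\ell_j}\}$ such that $b_j^a\succ_a\emptyset$; (3) for every $(a,\bar a)\in\mathcal C$ and every pair of activities $c_j,c_{j'}$: $b^a_j\succ_a b^a_{j'}$ if and only if $b^{\bar a}_j\succ_{\bar a}b^{\bar a}_{j'}$. A stable matching $M\in\mathcal S(I)$ is activity-stable if for each $(a,\bar a)\in\mathcal C$, $M(a)$ and $M(\bar a)$ are classes of the same activity. *)

theory Defs
  imports
    "HOL-Library.Disjoint_Sets"
    "HOL-Library.Log_Nat"
    "HOL-Computational_Algebra.Polynomial"
begin

section \<open>School matching\<close>

text \<open>
  The extension \<open>X\<close> to \<open>X\<^sup>+\<close> by the outside option: \<^term>\<open>None\<close> is the outside option.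
  A preference is a relation in which \<open>(x, y)\<close> means that \<open>x\<close> is strictly preferred to \<open>y\<close>.
\<close>

definition with_outside :: "'a set \<Rightarrow> 'a option set" where
  "with_outside X = insert None (Some ` X)"

definition strict_total_order :: "'a set \<Rightarrow> ('a \<times> 'a) set \<Rightarrow> bool" where
  "strict_total_order X r \<longleftrightarrow> r \<subseteq> X \<times> X \<and> strict_linear_order_on X r"

record ('a, 'b) school_matching =
  students :: "'a set"
  schools :: "'b set"
  student_pref :: "'a \<Rightarrow> ('b option \<times> 'b option) set"
  school_pref :: "'b \<Rightarrow> ('a option \<times> 'a option) set"
  quota :: "'b \<Rightarrow> nat"

definition school_matching_instance :: "('a, 'b, 'z) school_matching_scheme \<Rightarrow> bool" where
  "school_matching_instance I \<longleftrightarrow>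
     finite (students I) \<and> finite (schools I) \<and>
     (\<forall>a\<in>students I. strict_total_order (with_outside (schools I)) (student_pref I a)) \<and>
     (\<forall>b\<in>schools I. strict_total_order (with_outside (students I)) (school_pref I b)) \<and>
     (\<forall>b\<in>schools I. quota I b \<le> card (students I))"

definition partner_of_student :: "('a option \<times> 'b option) set \<Rightarrow> 'a \<Rightarrow> 'b option" where
  "partner_of_student M a = (THE y. (Some a, y) \<in> M)"

definition partners_of_school :: "('a option \<times> 'b option) set \<Rightarrow> 'b \<Rightarrow> 'a option set" where
  "partners_of_school M b = {x. (x, Some b) \<in> M}"

text \<open>
  ``At most \<open>q - 1\<close> students'' is written \<open>< q\<close>, as subtraction on \<^typ>\<open>nat\<close> truncates at \<open>q = 0\<close>.
\<close>

definition matching ::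
  "('a, 'b, 'z) school_matching_scheme \<Rightarrow> ('a option \<times> 'b option) set \<Rightarrow> bool" where
  "matching I M \<longleftrightarrow>
     M \<subseteq> (with_outside (students I) \<times> with_outside (schools I)) - {(None, None)} \<and>
     (\<forall>a\<in>students I. \<exists>!y. (Some a, y) \<in> M) \<and>
     (\<forall>b\<in>schools I.
        None \<notin> partners_of_school M b \<and> card (partners_of_school M b) = quota I b \<or>
        None \<in> partners_of_school M b \<and> card (partners_of_school M b - {None}) < quota I b)"

definition stable_matching ::
  "('a, 'b, 'z) school_matching_scheme \<Rightarrow> ('a option \<times> 'b option) set \<Rightarrow> bool" where
  "stable_matching I M \<longleftrightarrow>
     matching I M \<and>
     \<not> (\<exists>a\<in>students I. \<exists>b\<in>schools I.
          (Some b, partner_of_student M a) \<in> student_pref I a \<and>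
          (\<exists>x\<in>partners_of_school M b. (Some a, x) \<in> school_pref I b)) \<and>
     \<not> (\<exists>a\<in>students I. (None, partner_of_student M a) \<in> student_pref I a) \<and>
     \<not> (\<exists>b\<in>schools I. \<exists>x\<in>partners_of_school M b. (None, x) \<in> school_pref I b)"

section \<open>Siblings and activities\<close>

record ('a, 'b, 'c) mssp = "('a, 'b) school_matching" +
  siblings :: "('a \<times> 'a) set"
  activities :: "'c set"
  activity_classes :: "'c \<Rightarrow> 'b set"

definition acceptable_class :: "('a, 'b, 'c, 'z) mssp_scheme \<Rightarrow> 'a \<Rightarrow> 'c \<Rightarrow> 'b" where
  "acceptable_class I a c =
     (THE b. b \<in> activity_classes I c \<and> (Some b, None) \<in> student_pref I a)"

definition mssp_instance :: "('a, 'b, 'c, 'z) mssp_scheme \<Rightarrow> bool" where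
  "mssp_instance I \<longleftrightarrow>
     school_matching_instance I \<and>
     siblings I \<subseteq> students I \<times> students I \<and>
     (\<forall>(a, a')\<in>siblings I. a \<noteq> a') \<and>
     finite (activities I) \<and>
     (\<forall>c\<in>activities I. activity_classes I c \<noteq> {}) \<and>
     disjoint_family_on (activity_classes I) (activities I) \<and>
     (\<Union>c\<in>activities I. activity_classes I c) = schools I \<and>
     (\<forall>c\<in>activities I. \<forall>a\<in>students I.
        \<exists>!b. b \<in> activity_classes I c \<and> (Some b, None) \<in> student_pref I a) \<and>
     (\<forall>(a, a')\<in>siblings I. \<forall>c\<in>activities I. \<forall>c'\<in>activities I.
        (Some (acceptable_class I a c), Some (acceptable_class I a c')) \<in> student_pref I a \<longleftrightarrow>
        (Some (acceptable_class I a' c), Some (acceptable_class I a' c')) \<in> student_pref I a')"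

text \<open>Both siblings have to be assigned to classes; the outside option is not a class.\<close>

definition activity_stable ::
  "('a, 'b, 'c, 'z) mssp_scheme \<Rightarrow> ('a option \<times> 'b option) set \<Rightarrow> bool" where
  "activity_stable I M \<longleftrightarrow>
     stable_matching I M \<and>
     (\<forall>(a, a')\<in>siblings I. \<exists>c\<in>activities I.
        \<exists>b\<in>activity_classes I c. \<exists>b'\<in>activity_classes I c.
          partner_of_student M a = Some b \<and> partner_of_student M a' = Some b')"

section \<open>Random access machines with logarithmic cost\<close>

text \<open>
  A structured random access machine: finitely many registers are named in a program, and an
  unbounded memory is addressed indirectly through registers. Every instruction is charged the
  number of binary digits of the operands and addresses it handles (the logarithmic cost
  criterion), so that running times agree with those of multi-tape Turing machines up to a
  polynomial. Subtraction is truncated.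
\<close>

type_synonym state = "(nat \<Rightarrow> nat) \<times> (nat \<Rightarrow> nat)"  \<comment> \<open>registers and memory\<close>

datatype ram =
    Skip
  | Const nat nat
  | Add nat nat nat
  | Sub nat nat nat
  | Load nat nat
  | Store nat nat
  | Seq ram ram
  | IfNZ nat ram ram
  | WhileNZ nat ram

definition digits :: "nat \<Rightarrow> nat" where
  "digits n = max 1 (floorlog 2 n)"

text \<open>
  \<open>exec p s t s'\<close>: started in state \<open>s\<close>, program \<open>p\<close> halts in state \<open>s'\<close> after time \<open>t\<close>.
\<close>

inductive exec :: "ram \<Rightarrow> state \<Rightarrow> nat \<Rightarrow> state \<Rightarrow> bool" where
  Skip: "exec Skip s 1 s"
| Const: "exec (Const i n) (r, m) (digits n) (r(i := n), m)"
| Add: "exec (Add i j k) (r, m) (digits (r j) + digits (r k)) (r(i := r j + r k), m)"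
| Sub: "exec (Sub i j k) (r, m) (digits (r j) + digits (r k)) (r(i := r j - r k), m)"
| Load: "exec (Load i j) (r, m) (digits (r j) + digits (m (r j))) (r(i := m (r j)), m)"
| Store: "exec (Store i j) (r, m) (digits (r i) + digits (r j)) (r, m(r i := r j))"
| Seq: "exec p s t s' \<Longrightarrow> exec q s' u s'' \<Longrightarrow> exec (Seq p q) s (t + u) s''"
| IfTrue: "r i \<noteq> 0 \<Longrightarrow> exec p (r, m) t s \<Longrightarrow> exec (IfNZ i p q) (r, m) (digits (r i) + t) s"
| IfFalse: "r i = 0 \<Longrightarrow> exec q (r, m) t s \<Longrightarrow> exec (IfNZ i p q) (r, m) (digits (r i) + t) s"
| WhileFalse: "r i = 0 \<Longrightarrow> exec (WhileNZ i p) (r, m) (digits (r i)) (r, m)"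
| WhileTrue: "r i \<noteq> 0 \<Longrightarrow> exec p (r, m) t s \<Longrightarrow> exec (WhileNZ i p) s u s' \<Longrightarrow>
    exec (WhileNZ i p) (r, m) (digits (r i) + t + u) s'"

inductive_cases exec_elims [elim!]:
  "exec Skip s t s'" "exec (Const i n) s t s'" "exec (Add i j k) s t s'"
  "exec (Sub i j k) s t s'" "exec (Load i j) s t s'" "exec (Store i j) s t s'"
  "exec (Seq p q) s t s'" "exec (IfNZ i p q) s t s'"
inductive_cases exec_While: "exec (WhileNZ i p) s t s'"

lemma exec_deterministic:
  "exec p s t s' \<Longrightarrow> exec p s u s'' \<Longrightarrow> u = t \<and> s'' = s'"
proof (induction arbitrary: u s'' rule: exec.induct)
  case (WhileFalse r i p m)
  from WhileFalse.prems show ?case by (rule exec_While) (use WhileFalse.hyps in auto)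
next
  case (WhileTrue r i p m t s u' s1)
  from WhileTrue.prems show ?case
  proof (rule exec_While, goal_cases)
    case 1
    then show ?thesis using WhileTrue.hyps by simp
  next
    case (2 r' m' t2 s2 u2)
    then have "t2 = t \<and> s2 = s" using WhileTrue.IH(1) by auto
    then show ?thesis using 2 WhileTrue.IH(2) by auto
  qed
next
  case (Seq p s t s' q u' s1)
  from Seq.prems obtain t2 s2 u2 where
    "exec p s t2 s2" "exec q s2 u2 s''" "u = t2 + u2" by auto
  moreover from this(1) have "t2 = t \<and> s2 = s'" by (rule Seq.IH(1))
  ultimately show ?case using Seq.IH(2) by auto
next
  case (IfTrue r i p m t s q)
  from IfTrue.prems IfTrue.hyps obtain t2 where
    "exec p (r, m) t2 s''" "u = digits (r i) + t2" by auto
  then show ?case using IfTrue.IH by auto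
next
  case (IfFalse r i q m t s p)
  from IfFalse.prems IfFalse.hyps obtain t2 where
    "exec q (r, m) t2 s''" "u = digits (r i) + t2" by auto
  then show ?case using IfFalse.IH by auto
qed auto

text \<open>
  Register 0 initially holds the length of the input, which occupies the first memory cells;
  all other registers and cells are 0. The size of an input is its total number of digits.
\<close>

definition initial_state :: "nat list \<Rightarrow> state" where
  "initial_state w =
     ((\<lambda>_. 0)(0 := length w), (\<lambda>i. if i < length w then w ! i else 0))"

definition input_size :: "nat list \<Rightarrow> nat" where
  "input_size w = (\<Sum>x\<leftarrow>w. digits x)"

text \<open>
  One program and one polynomial have to serve all instances in \<open>D\<close> and all their encodings.
  The answer, 1 for yes and 0 for no, is left in register 0.
\<close>

definition decidable_in_polynomial_time ::
  "('i \<Rightarrow> nat list \<Rightarrow> bool) \<Rightarrow> 'i set \<Rightarrow> ('i \<Rightarrow> bool) \<Rightarrow> bool" where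
  "decidable_in_polynomial_time encodes D Q \<longleftrightarrow>
     (\<exists>(p :: ram) (f :: nat poly). \<forall>I\<in>D. \<forall>w. encodes I w \<longrightarrow>
        (\<exists>t r m. exec p (initial_state w) t (r, m) \<and>
           t \<le> poly f (input_size w) \<and> r 0 = (if Q I then 1 else 0)))"

section \<open>Encoding of instances\<close>

text \<open>
  Students, classes and activities are encoded by their positions in arbitrary enumerations
  \<open>as\<close>, \<open>bs\<close>, \<open>cs\<close>, so an encoding does not depend on their names. A preference order is given
  by the position of each option in the preference list (0 for the most preferred one), with
  the outside option first; activities and sibling pairs by 0/1 incidence matrices.
\<close>

definition pref_position :: "('a \<times> 'a) set \<Rightarrow> 'a \<Rightarrow> nat" where
  "pref_position r x = card {y. (y, x) \<in> r}"

definition encode_mssp ::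
  "('a, 'b, 'c) mssp \<Rightarrow> 'a list \<Rightarrow> 'b list \<Rightarrow> 'c list \<Rightarrow> nat list" where
  "encode_mssp I as bs cs =
     [length as, length bs, length cs] @
     map (quota I) bs @
     concat (map (\<lambda>a. map (pref_position (student_pref I a)) (None # map Some bs)) as) @
     concat (map (\<lambda>b. map (pref_position (school_pref I b)) (None # map Some as)) bs) @
     concat (map (\<lambda>c. map (\<lambda>b. of_bool (b \<in> activity_classes I c)) bs) cs) @
     concat (map (\<lambda>a. map (\<lambda>a'. of_bool ((a, a') \<in> siblings I)) as) as)"

definition mssp_encoding :: "('a, 'b, 'c) mssp \<Rightarrow> nat list \<Rightarrow> bool" where
  "mssp_encoding I w \<longleftrightarrow>
     (\<exists>as bs cs. distinct as \<and> set as = students I \<and> distinct bs \<and> set bs = schools I \<and>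
        distinct cs \<and> set cs = activities I \<and> w = encode_mssp I as bs cs)"

lemma mssp_encoding_exists:
  assumes "mssp_instance I"
  shows "\<exists>w. mssp_encoding I w"
proof -
  have "finite (students I)" "finite (schools I)" "finite (activities I)"
    using assms by (auto simp: mssp_instance_def school_matching_instance_def)
  then obtain as bs cs where
    "distinct as" "set as = students I" "distinct bs" "set bs = schools I"
    "distinct cs" "set cs = activities I"
    by (metis finite_distinct_list)
  then show ?thesis
    unfolding mssp_encoding_def by blast
qed

end

theory Submission
  imports Defs
begin

text \<open>
  All students accept equally many classes, one per activity, and siblings rank the activities
  alike. Hence two siblings attend the same activity iff their assigned classes have the same
  position in their two preference lists and precede the outside option there. So a matching is
  sought as a vector of positions, one per student. Starting from 0, a position is increased
  whenever no solution can use it: the class refuses the student, or has enough better students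
  that have not moved past it, or a sibling has already moved further. The vector remains below
  every solution and becomes stationary after polynomially many steps. The stationary vector is a
  solution unless a sibling is unassigned or a class with a vacancy would take a student who
  prefers it; in the latter case, counting assigned students shows that there is no solution at all.
\<close>

section \<open>Deferred acceptance on positions\<close>

text \<open>Coupling siblings destroys the usual guarantee of deferred acceptance: a student dragged
  forward by a sibling leaves a class that never refused it, so a seat may fall vacant that this
  student, or one displaced earlier, prefers. Hence the stationary vector need not be stable, and
  \<open>accepting\<close> is a genuine final test. What survives is one half of the lattice
  structure: agreement is an equality of numbers, and each reason to advance a student persists
  while the other positions grow, so nothing is ever taken back. To that end \<open>rejected\<close>
  counts, against a seat, every better student that has reached or already passed the class,
  including those no longer seated there.

  On the machine side all stored numbers are small: quotas, positions and sizes are at most the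
  length of the input, so costs can be estimated by values instead of digits. The program is
  assembled from an expression language whose only iteration is a bounded sum; polynomial bounds on
  values and times then follow by recursion on the syntax.\<close>

text \<open>
  \<open>p a b\<close> is the position of \<open>b\<close> in the list of \<open>a\<close>, \<open>Q b a\<close> that of \<open>a\<close> in the list of \<open>b\<close>;
  \<open>p0\<close> and \<open>Q0\<close> are the positions of the outside option, \<open>q\<close> are the quotas.
\<close>

locale sibling_market =
  fixes A :: "'a set" and B :: "'b set"
    and p :: "'a \<Rightarrow> 'b \<Rightarrow> nat" and p0 :: "'a \<Rightarrow> nat"
    and Q :: "'b \<Rightarrow> 'a \<Rightarrow> nat" and Q0 :: "'b \<Rightarrow> nat"
    and q :: "'b \<Rightarrow> nat" and S :: "('a \<times> 'a) set"
  assumes finite_A [simp]: "finite A" and finite_B [simp]: "finite B"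
    and inj_p: "a \<in> A \<Longrightarrow> inj_on (p a) B"
    and p_neq: "a \<in> A \<Longrightarrow> b \<in> B \<Longrightarrow> p a b \<noteq> p0 a"
    and p_surj: "a \<in> A \<Longrightarrow> k < p0 a \<Longrightarrow> \<exists>b\<in>B. p a b = k"
    and inj_Q: "b \<in> B \<Longrightarrow> inj_on (Q b) A"
    and Q_neq: "b \<in> B \<Longrightarrow> a \<in> A \<Longrightarrow> Q b a \<noteq> Q0 b"
    and S_subset: "S \<subseteq> A \<times> A"
begin

definition seats :: "('a \<Rightarrow> nat) \<Rightarrow> 'b \<Rightarrow> 'a set" where
  "seats c b = {a \<in> A. p a b = c a}"

definition stable_at :: "('a \<Rightarrow> nat) \<Rightarrow> bool" where
  "stable_at c \<longleftrightarrow> (\<forall>a\<in>A. c a \<le> p0 a) \<and>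
     (\<forall>b\<in>B. card (seats c b) \<le> q b \<and> (\<forall>a\<in>seats c b. Q b a < Q0 b) \<and>
       (\<forall>a\<in>A. p a b < c a \<longrightarrow>
          (\<forall>a'\<in>seats c b. Q b a' < Q b a) \<and> (card (seats c b) < q b \<longrightarrow> Q0 b < Q b a)))"

definition siblings_agree :: "('a \<Rightarrow> nat) \<Rightarrow> bool" where
  "siblings_agree c \<longleftrightarrow> (\<forall>(a, a')\<in>S. c a = c a' \<and> c a < p0 a \<and> c a' < p0 a')"

text \<open>The count contains students already past \<open>b\<close> as well as those standing at
  it. In a stable vector above \<open>c\<close>, each of them either sits at \<open>b\<close> or
  prefers \<open>b\<close> to its own position and would then envy \<open>a\<close> a seat there. So
  a claim to \<open>b\<close> is not forgotten when its holder moves on.\<close>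

definition rejected :: "('a \<Rightarrow> nat) \<Rightarrow> 'a \<Rightarrow> bool" where
  "rejected c a \<longleftrightarrow> c a < p0 a \<and>
     ((\<exists>b\<in>B. p a b = c a \<and>
         (Q0 b < Q b a \<or> q b \<le> card {a'\<in>A. p a' b \<le> c a' \<and> Q b a' < Q b a})) \<or>
      (\<exists>a'\<in>A. ((a, a') \<in> S \<or> (a', a) \<in> S) \<and> c a < c a'))"

text \<open>These are the two properties that the absence of rejections does not enforce: a seat may
  be vacant after a sibling had to leave it, and siblings may have run out of classes, in which case
  \<open>rejected\<close> is disabled by \<open>c a < p0 a\<close>.\<close>

definition accepting :: "('a \<Rightarrow> nat) \<Rightarrow> bool" where
  "accepting c \<longleftrightarrow>
     (\<forall>a\<in>A. \<forall>b\<in>B. p a b < c a \<and> Q b a < Q0 b \<longrightarrow> q b \<le> card (seats c b)) \<and>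
     (\<forall>a\<in>A. \<forall>a'\<in>A. (a, a') \<in> S \<longrightarrow> c a < p0 a \<and> c a' < p0 a')"

text \<open>Without any solution the second part is vacuous; the bound by \<open>p0\<close> alone
  then limits how far the positions can grow.\<close>

definition lower_bound :: "('a \<Rightarrow> nat) \<Rightarrow> bool" where
  "lower_bound c \<longleftrightarrow> (\<forall>a\<in>A. c a \<le> p0 a) \<and>
     (\<forall>d. stable_at d \<longrightarrow> siblings_agree d \<longrightarrow> (\<forall>a\<in>A. c a \<le> d a))"

lemma finite_seats [simp]: "finite (seats c b)"
  by (simp add: seats_def)

lemma lower_bound_zero: "lower_bound (\<lambda>_. 0)"
  by (simp add: lower_bound_def)

text \<open>Suppose \<open>d a = c a\<close>. A sibling ahead in \<open>c\<close> would be ahead in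
  \<open>d\<close>, and a refusing class contradicts stability. Otherwise all better students
  counted in \<open>rejected\<close> sit at \<open>b\<close> in \<open>d\<close>, and together with
  \<open>a\<close> they exceed the quota.\<close>

lemma rejected_not_optimal:
  assumes c: "lower_bound c" and d: "stable_at d" "siblings_agree d"
    and a: "a \<in> A" and rej: "rejected c a"
  shows "c a < d a"
proof (rule ccontr)
  assume "\<not> c a < d a"
  have le: "c a' \<le> d a'" if "a' \<in> A" for a' using c d that by (auto simp: lower_bound_def)
  have eq: "d a = c a" using \<open>\<not> c a < d a\<close> le[OF a] by simp
  from rej consider
    (over) b where "b \<in> B" "p a b = c a"
      "Q0 b < Q b a \<or> q b \<le> card {a'\<in>A. p a' b \<le> c a' \<and> Q b a' < Q b a}"
    | (sib) a' where "a' \<in> A" "(a, a') \<in> S \<or> (a', a) \<in> S" "c a < c a'"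
    by (auto simp: rejected_def)
  then show False
  proof cases
    case sib
    then have "d a = d a'" using d(2) by (auto simp: siblings_agree_def)
    then show False using sib eq le[of a'] by simp
  next
    case over
    have seat: "a \<in> seats d b" using over eq a by (simp add: seats_def)
    then have "Q b a < Q0 b" using d(1) over by (auto simp: stable_at_def)
    then have card_le: "q b \<le> card {a'\<in>A. p a' b \<le> c a' \<and> Q b a' < Q b a}" (is "_ \<le> card ?W")
      using over by auto
    \<comment> \<open>Having reached or passed \<open>b\<close> in \<open>c\<close>, such a student
      is at \<open>b\<close> or past it in \<open>d\<close>; if past it, it would envy
      \<open>a\<close>.\<close>
    have "a' \<in> seats d b" if "a' \<in> ?W" for a'
    proof (rule ccontr)
      assume "a' \<notin> seats d b"
      then have "p a' b < d a'" using that le[of a'] by (auto simp: seats_def)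
      then have "Q b a < Q b a'" using d(1) over seat that by (auto simp: stable_at_def)
      then show False using that by simp
    qed
    then have "insert a ?W \<subseteq> seats d b" using seat by blast
    then have "card (insert a ?W) \<le> card (seats d b)" by (intro card_mono) auto
    moreover have "card (insert a ?W) = Suc (card ?W)" by (subst card_insert_disjoint) auto
    moreover have "card (seats d b) \<le> q b" using d(1) over by (auto simp: stable_at_def)
    ultimately show False using card_le by simp
  qed
qed

lemma lower_bound_step:
  assumes "lower_bound c" "a \<in> A" "rejected c a"
  shows "lower_bound (c(a := Suc (c a)))"
proof -
  have "Suc (c a) \<le> p0 a" using assms(3) by (auto simp: rejected_def)
  moreover have "Suc (c a) \<le> d a" if "stable_at d" "siblings_agree d" for d
    using rejected_not_optimal[OF assms(1) that assms(2,3)] by simp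
  ultimately show ?thesis
    using assms(1,2) unfolding lower_bound_def by auto
qed

text \<open>By \<open>p_surj\<close> and \<open>inj_p\<close>, each position before the outside
  option is a seat at exactly one class.\<close>

lemma sum_card_seats:
  assumes "\<forall>a\<in>A. c a \<le> p0 a" "\<And>b a. b \<in> B \<Longrightarrow> a \<in> seats c b \<Longrightarrow> p a b < p0 a"
  shows "(\<Sum>b\<in>B. card (seats c b)) = card {a\<in>A. c a < p0 a}"
proof -
  have "(\<Union>b\<in>B. seats c b) = {a\<in>A. c a < p0 a}"
  proof (intro equalityI subsetI)
    fix a assume "a \<in> {a\<in>A. c a < p0 a}"
    then show "a \<in> (\<Union>b\<in>B. seats c b)" using p_surj[of a "c a"] by (auto simp: seats_def)
  next
    fix a assume "a \<in> (\<Union>b\<in>B. seats c b)"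
    then show "a \<in> {a\<in>A. c a < p0 a}" using assms(2)[of _ a] by (auto simp: seats_def)
  qed
  moreover have "card (\<Union>b\<in>B. seats c b) = (\<Sum>b\<in>B. card (seats c b))"
    by (rule card_UN_disjoint) (auto simp: seats_def inj_on_eq_iff[OF inj_p] dest: sym)
  ultimately show ?thesis by simp
qed

lemma seat_acceptable:
  assumes "\<forall>a\<in>A. c a \<le> p0 a" "b \<in> B" "a \<in> seats c b"
  shows "c a < p0 a" "p a b < p0 a"
proof -
  have "c a \<le> p0 a" "p a b = c a" "p a b \<noteq> p0 a"
    using assms p_neq by (auto simp: seats_def)
  then show "c a < p0 a" "p a b < p0 a" by auto
qed

section \<open>Vectors without rejections\<close>

context
  fixes c
  assumes bd: "\<forall>a\<in>A. c a \<le> p0 a" and fixp: "\<forall>a\<in>A. \<not> rejected c a"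
begin

lemma seat_preferred:
  assumes "b \<in> B" "a \<in> seats c b" shows "Q b a < Q0 b"
proof -
  have "a \<in> A" "p a b = c a" using assms(2) by (auto simp: seats_def)
  then have "\<not> Q0 b < Q b a"
    using fixp seat_acceptable[OF bd assms] assms(1) by (auto simp: rejected_def)
  moreover have "Q b a \<noteq> Q0 b" using Q_neq assms(1) \<open>a \<in> A\<close> by simp
  ultimately show ?thesis by simp
qed

lemma few_better:
  assumes "b \<in> B" "a \<in> seats c b"
  shows "card {a'\<in>A. p a' b \<le> c a' \<and> Q b a' < Q b a} < q b"
proof -
  have "a \<in> A" "p a b = c a" using assms(2) by (auto simp: seats_def)
  then have "\<not> rejected c a" "c a < p0 a" using fixp seat_acceptable[OF bd assms] by auto
  then show ?thesis using assms(1) \<open>p a b = c a\<close> unfolding rejected_def not_less[symmetric] by blast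
qed

lemma worst_seat:
  assumes "b \<in> B" "seats c b \<noteq> {}"
  obtains a where "a \<in> seats c b" "\<And>a'. a' \<in> seats c b \<Longrightarrow> a' = a \<or> Q b a' < Q b a"
proof -
  have "Max (Q b ` seats c b) \<in> Q b ` seats c b" using assms by (intro Max_in) auto
  then obtain a where a: "a \<in> seats c b" "Q b a = Max (Q b ` seats c b)" by auto
  have "a' = a \<or> Q b a' < Q b a" if "a' \<in> seats c b" for a'
  proof -
    have "Q b a' \<le> Q b a" using that a by simp
    moreover have "a' = a" if "Q b a' = Q b a"
      using inj_onD[OF inj_Q[OF assms(1)] that] a(1) \<open>a' \<in> seats c b\<close> by (simp add: seats_def)
    ultimately show ?thesis by linarith
  qed
  with a that show thesis by blast
qed

text \<open>The worst occupant is not rejected although every other occupant counts against it, so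
  there are fewer than \<open>q b\<close> others.\<close>

lemma seats_le_quota:
  assumes "b \<in> B" shows "card (seats c b) \<le> q b"
proof (cases "seats c b = {}")
  case False
  with assms obtain a where a: "a \<in> seats c b"
    "\<And>a'. a' \<in> seats c b \<Longrightarrow> a' = a \<or> Q b a' < Q b a" by (rule worst_seat) blast
  have "seats c b - {a} \<subseteq> {a'\<in>A. p a' b \<le> c a' \<and> Q b a' < Q b a}"
    using a(2) by (auto simp: seats_def)
  then have "card (seats c b - {a}) \<le> card {a'\<in>A. p a' b \<le> c a' \<and> Q b a' < Q b a}"
    by (intro card_mono) auto
  then show ?thesis using few_better[OF assms a(1)] a(1) by (simp add: card_Diff_singleton)
qed simp

text \<open>A student past \<open>b\<close> still counts against the worst occupant of
  \<open>b\<close>. If it were better than some occupant of a full class, it would make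
  \<open>q b\<close> better students together with the remaining occupants, and the worst occupant
  would be rejected. That the class is full comes from \<open>accepting\<close>.\<close>

lemma accepting_imp_stable:
  assumes acc: "accepting c"
  shows "stable_at c"
  unfolding stable_at_def
proof (intro conjI ballI impI)
  fix a b a' assume b: "b \<in> B" and a: "a \<in> A" "p a b < c a" and a': "a' \<in> seats c b"
  show "Q b a' < Q b a"
  proof (rule ccontr)
    assume "\<not> Q b a' < Q b a"
    then have lt: "Q b a \<le> Q b a'" by simp
    then have "Q b a < Q0 b" using seat_preferred[OF b a'] by simp
    then have full: "q b \<le> card (seats c b)" using acc a b by (auto simp: accepting_def)
    obtain w where w: "w \<in> seats c b"
      "\<And>a'. a' \<in> seats c b \<Longrightarrow> a' = w \<or> Q b a' < Q b w" using worst_seat[OF b] a' by blast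
    have nin: "a \<notin> seats c b" using a by (auto simp: seats_def)
    have "Q b a \<le> Q b w" using lt w(2)[OF a'] by auto
    moreover have "Q b a \<noteq> Q b w"
    proof
      assume "Q b a = Q b w"
      then have "a = w" using inj_onD[OF inj_Q[OF b]] a(1) w(1) by (auto simp: seats_def)
      then show False using w(1) nin by simp
    qed
    ultimately have "insert a (seats c b - {w}) \<subseteq> {a'\<in>A. p a' b \<le> c a' \<and> Q b a' < Q b w}"
      using w(2) a by (auto simp: seats_def)
    then have "card (insert a (seats c b - {w}))
        \<le> card {a'\<in>A. p a' b \<le> c a' \<and> Q b a' < Q b w}" by (intro card_mono) auto
    moreover have "card (insert a (seats c b - {w})) = Suc (card (seats c b - {w}))"
      using nin by (subst card_insert_disjoint) auto
    moreover have "Suc (card (seats c b - {w})) = card (seats c b)"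
      using w(1) by (intro card.remove[symmetric]) auto
    ultimately show False using few_better[OF b w(1)] full by simp
  qed
next
  fix a b assume b: "b \<in> B" and a: "a \<in> A" "p a b < c a" and room: "card (seats c b) < q b"
  then have "\<not> Q b a < Q0 b" using acc by (fastforce simp: accepting_def)
  moreover have "Q b a \<noteq> Q0 b" using Q_neq b a by simp
  ultimately show "Q0 b < Q b a" by simp
qed (use bd seats_le_quota seat_preferred in auto)

text \<open>A lagging sibling is rejected as long as it stands before the outside option, which
  \<open>accepting\<close> guarantees; so at a stationary vector neither one lags.\<close>

lemma accepting_imp_agree:
  assumes acc: "accepting c"
  shows "siblings_agree c"
  unfolding siblings_agree_def
proof (intro ballI, clarify, intro conjI)
  fix a a' assume s: "(a, a') \<in> S"
  then have in_A: "a \<in> A" "a' \<in> A" using S_subset by auto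
  with s acc show lt: "c a < p0 a" "c a' < p0 a'" by (auto simp: accepting_def)
  have "\<not> rejected c a" "\<not> rejected c a'" using fixp in_A by auto
  then have "\<not> c a < c a'" "\<not> c a' < c a" using s lt in_A by (auto simp: rejected_def)
  then show "c a = c a'" by simp
qed

text \<open>
  A vacant seat that a student of \<^term>\<open>c\<close> covets would have to be filled in every solution
  \<^term>\<open>d\<close>; but \<^term>\<open>d\<close> assigns no more students than \<^term>\<open>c\<close>, so \<^term>\<open>d\<close> would leave a
  vacancy at another school, which blocks \<^term>\<open>d\<close>.
\<close>

lemma solution_imp_accepting:
  assumes lb: "lower_bound c" and d: "stable_at d" "siblings_agree d"
  shows "accepting c"
  unfolding accepting_def
proof (intro conjI ballI impI)
  fix a a' assume "a \<in> A" "a' \<in> A" "(a, a') \<in> S"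
  then have "c a \<le> d a" "c a' \<le> d a'" "d a < p0 a" "d a' < p0 a'"
    using lb d by (auto simp: lower_bound_def siblings_agree_def)
  then show "c a < p0 a" "c a' < p0 a'" by simp_all
next
  fix a b assume ab: "a \<in> A" "b \<in> B" and block: "p a b < c a \<and> Q b a < Q0 b"
  show "q b \<le> card (seats c b)"
  proof (rule ccontr)
    assume vac: "\<not> q b \<le> card (seats c b)"
    have le: "c a' \<le> d a'" if "a' \<in> A" for a' using lb d that by (auto simp: lower_bound_def)
    have dbd: "\<forall>a\<in>A. d a \<le> p0 a" using d(1) by (simp add: stable_at_def)
    have "p a b < d a" using le[OF ab(1)] block by simp
    then have "card (seats d b) < q b \<longrightarrow> Q0 b < Q b a"
      using d(1) ab by (auto simp: stable_at_def)
    then have "q b \<le> card (seats d b)" using block by force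
    with vac have more: "card (seats c b) < card (seats d b)" by simp
    have "(\<Sum>b\<in>B. card (seats d b)) = card {a\<in>A. d a < p0 a}"
      using seat_acceptable[OF dbd] by (intro sum_card_seats[OF dbd]) auto
    \<comment> \<open>As \<open>c\<close> is below \<open>d\<close>, a student assigned in
      \<open>d\<close> stands before the outside option in \<open>c\<close> too.\<close>
    also have "\<dots> \<le> card {a\<in>A. c a < p0 a}"
      using le by (intro card_mono) (auto intro: le_less_trans)
    also have "\<dots> = (\<Sum>b\<in>B. card (seats c b))"
      using seat_acceptable[OF bd] by (intro sum_card_seats[OF bd, symmetric]) auto
    finally have total: "(\<Sum>b\<in>B. card (seats d b)) \<le> (\<Sum>b\<in>B. card (seats c b))" .
    obtain b' where b': "b' \<in> B" "card (seats d b') < card (seats c b')"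
    proof (rule ccontr)
      assume "\<not> thesis"
      with that have "\<And>b'. b' \<in> B \<Longrightarrow> card (seats c b') \<le> card (seats d b')"
        using not_less by blast
      then have "(\<Sum>b\<in>B. card (seats c b)) < (\<Sum>b\<in>B. card (seats d b))"
        using more ab by (intro sum_strict_mono_ex1) auto
      with total show False by simp
    qed
    have "\<not> seats c b' \<subseteq> seats d b'" using b'(2) by (auto dest: card_mono[rotated])
    then obtain a' where a': "a' \<in> seats c b'" "a' \<notin> seats d b'" by auto
    then have "a' \<in> A" "p a' b' < d a'" using le[of a'] by (auto simp: seats_def)
    moreover have "card (seats d b') < q b'" using b' seats_le_quota[of b'] by simp
    ultimately have "Q0 b' < Q b' a'" using d(1) b'(1) by (auto simp: stable_at_def)
    then show False using seat_preferred[OF b'(1) a'(1)] by simp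
  qed
qed

end

lemma accepting_iff_solvable:
  assumes lb: "lower_bound c" and fixp: "\<forall>a\<in>A. \<not> rejected c a"
  shows "accepting c \<longleftrightarrow> (\<exists>d. stable_at d \<and> siblings_agree d)"
proof -
  have bd: "\<forall>a\<in>A. c a \<le> p0 a" using lb by (simp add: lower_bound_def)
  show ?thesis
    using accepting_imp_stable[OF bd fixp] accepting_imp_agree[OF bd fixp]
      solution_imp_accepting[OF bd fixp lb] by blast
qed

section \<open>Termination of the sweeps\<close>

definition reject_step :: "'a \<Rightarrow> ('a \<Rightarrow> nat) \<Rightarrow> ('a \<Rightarrow> nat)" where
  "reject_step a c = c(a := c a + of_bool (rejected c a))"

text \<open>The steps act one after the other, each seeing the changes made by the previous ones;
  this matches in-place updates of the memory.\<close>

definition sweep :: "'a list \<Rightarrow> ('a \<Rightarrow> nat) \<Rightarrow> ('a \<Rightarrow> nat)" where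
  "sweep as = fold reject_step as"

lemma lower_bound_reject_step:
  "lower_bound c \<Longrightarrow> a \<in> A \<Longrightarrow> lower_bound (reject_step a c)"
  using lower_bound_step[of c a] by (auto simp: reject_step_def)

lemma lower_bound_sweep:
  "lower_bound c \<Longrightarrow> set as \<subseteq> A \<Longrightarrow> lower_bound (sweep as c)"
  unfolding sweep_def by (induction as arbitrary: c) (auto intro: lower_bound_reject_step)

lemma lower_bound_sweeps:
  "lower_bound c \<Longrightarrow> set as \<subseteq> A \<Longrightarrow> lower_bound ((sweep as ^^ k) c)"
  by (induction k) (auto intro: lower_bound_sweep)

lemma sum_reject_step:
  assumes "a \<in> A"
  shows "sum (reject_step a c) A = sum c A + of_bool (rejected c a)"
  using assms by (simp add: reject_step_def sum.remove[of A a])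

text \<open>The sum of the positions serves as potential: a rejection raises it and no step lowers
  it, so an unchanged sum certifies an idle sweep.\<close>

lemma sum_sweep:
  assumes "set as \<subseteq> A"
  shows "sum c A \<le> sum (sweep as c) A \<and>
    (sum (sweep as c) A \<le> sum c A \<longrightarrow> sweep as c = c \<and> (\<forall>a\<in>set as. \<not> rejected c a))"
  using assms
proof (induction as arbitrary: c)
  case (Cons a as)
  have "sum (reject_step a c) A = sum c A + of_bool (rejected c a)"
    using Cons.prems by (intro sum_reject_step) simp
  moreover have "reject_step a c = c" if "\<not> rejected c a"
    using that by (simp add: reject_step_def)
  ultimately show ?case
    using Cons.IH[of "reject_step a c"] Cons.prems by (cases "rejected c a") (auto simp: sweep_def)
qed (simp add: sweep_def)

text \<open>Every sweep that is not idle raises the potential, which cannot exceed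
  \<open>sum p0 A\<close>. A number of rounds known in advance thus replaces a test for stationarity
  in the program.\<close>

lemma sweeps_fixpoint:
  assumes as: "set as = A" and lb: "lower_bound c" and k: "sum p0 A < k"
  shows "\<forall>a\<in>A. \<not> rejected ((sweep as ^^ k) c) a"
proof -
  \<comment> \<open>A stationary vector stays stationary, so the first alternative persists;
    otherwise the second one advances by one per sweep.\<close>
  have progress: "(\<forall>a\<in>A. \<not> rejected ((sweep as ^^ j) c) a) \<or> j \<le> sum ((sweep as ^^ j) c) A" for j
  proof (induction j)
    case (Suc j)
    let ?c = "(sweep as ^^ j) c"
    have s: "sum ?c A \<le> sum (sweep as ?c) A"
      "sum (sweep as ?c) A \<le> sum ?c A \<Longrightarrow> sweep as ?c = ?c \<and> (\<forall>a\<in>A. \<not> rejected ?c a)"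
      using sum_sweep[of as ?c] as by auto
    show ?case
    proof (cases "\<forall>a\<in>A. \<not> rejected ?c a")
      case True
      then have "sweep as' ?c = ?c" if "set as' \<subseteq> A" for as'
        using that by (induction as') (auto simp: sweep_def reject_step_def)
      then show ?thesis using True as by simp
    next
      case False
      then show ?thesis using s Suc by (auto simp: not_le)
    qed
  qed simp
  have "lower_bound ((sweep as ^^ k) c)" using lb as by (intro lower_bound_sweeps) auto
  then have "sum ((sweep as ^^ k) c) A \<le> sum p0 A"
    by (intro sum_mono) (auto simp: lower_bound_def)
  then show ?thesis using progress[of k] k by auto
qed

end

section \<open>Stable matchings as position vectors\<close>

lemma pref_position_less_iff:
  assumes r: "strict_total_order X r" and fin: "finite X" and xy: "x \<in> X" "y \<in> X"
  shows "pref_position r x < pref_position r y \<longleftrightarrow> (x, y) \<in> r"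
proof -
  have sub: "r \<subseteq> X \<times> X" and tr: "trans r" and irr: "irrefl r" and tot: "total_on X r"
    using r by (auto simp: strict_total_order_def strict_linear_order_on_def)
  have fin': "finite {z. (z, x) \<in> r}" for x
    by (rule finite_subset[OF _ fin]) (use sub in auto)
  have lt: "pref_position r x < pref_position r y" if "(x, y) \<in> r" for x y
  proof -
    have "{z. (z, x) \<in> r} \<subseteq> {z. (z, y) \<in> r}" using that tr by (auto dest: transD)
    moreover have "x \<in> {z. (z, y) \<in> r}" "x \<notin> {z. (z, x) \<in> r}"
      using that irr by (auto simp: irrefl_def)
    ultimately have "{z. (z, x) \<in> r} \<subset> {z. (z, y) \<in> r}" by blast
    then show ?thesis unfolding pref_position_def using fin' by (rule psubset_card_mono[rotated])
  qed
  show ?thesis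
  proof
    assume less: "pref_position r x < pref_position r y"
    then have "x \<noteq> y" by auto
    then have "(x, y) \<in> r \<or> (y, x) \<in> r" using tot xy by (auto simp: total_on_def)
    moreover have "(y, x) \<notin> r" using lt[of y x] less by auto
    ultimately show "(x, y) \<in> r" by blast
  qed (rule lt)
qed

lemma pref_position_inj_on:
  assumes r: "strict_total_order X r" and fin: "finite X"
  shows "inj_on (pref_position r) X"
proof (rule inj_onI)
  fix x y assume *: "x \<in> X" "y \<in> X" "pref_position r x = pref_position r y"
  then have "(x, y) \<notin> r" "(y, x) \<notin> r"
    using pref_position_less_iff[OF r fin] by fastforce+
  then show "x = y"
    using r * by (auto simp: strict_total_order_def strict_linear_order_on_def total_on_def)
qed

text \<open>Injectivity and the bound \<open>card X\<close> force every value to occur. Because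
  there are no gaps, every number up to the position of the outside option is a possible
  assignment.\<close>

lemma pref_position_image:
  assumes r: "strict_total_order X r" and fin: "finite X"
  shows "pref_position r ` X = {..<card X}"
proof (rule card_subset_eq)
  have "pref_position r x < card X" if "x \<in> X" for x
  proof -
    have "{z. (z, x) \<in> r} \<subseteq> X - {x}"
      using r by (auto simp: strict_total_order_def strict_linear_order_on_def irrefl_def)
    then have "pref_position r x \<le> card (X - {x})"
      unfolding pref_position_def using fin by (intro card_mono) auto
    also have "\<dots> < card X" using fin that by (rule card_Diff1_less)
    finally show ?thesis .
  qed
  then show "pref_position r ` X \<subseteq> {..<card X}" by auto
  show "card (pref_position r ` X) = card {..<card X}"
    using card_image[OF pref_position_inj_on[OF r fin]] by simp
qed simp

section \<open>Instances as sibling markets\<close>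

locale mssp_positions =
  fixes I :: "('a, 'b, 'c, 'z) mssp_scheme"
  assumes mssp: "mssp_instance I"
begin

abbreviation "pos a y \<equiv> pref_position (student_pref I a) y"
abbreviation "spos b x \<equiv> pref_position (school_pref I b) x"

lemma finite_sets: "finite (students I)" "finite (schools I)" "finite (activities I)"
  using mssp by (auto simp: mssp_instance_def school_matching_instance_def)

lemma finite_outside [simp]:
  "finite (with_outside (students I))" "finite (with_outside (schools I))"
  using finite_sets by (auto simp: with_outside_def)

lemma in_outside [simp]: "None \<in> with_outside X" "Some x \<in> with_outside X \<longleftrightarrow> x \<in> X"
  by (auto simp: with_outside_def)

lemma student_order: "a \<in> students I \<Longrightarrow> strict_total_order (with_outside (schools I)) (student_pref I a)"
  and school_order: "b \<in> schools I \<Longrightarrow> strict_total_order (with_outside (students I)) (school_pref I b)"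
  using mssp by (auto simp: mssp_instance_def school_matching_instance_def)

lemma student_pref_iff:
  "a \<in> students I \<Longrightarrow> x \<in> with_outside (schools I) \<Longrightarrow> y \<in> with_outside (schools I) \<Longrightarrow>
    (x, y) \<in> student_pref I a \<longleftrightarrow> pos a x < pos a y"
  by (simp add: pref_position_less_iff[OF student_order])

lemma school_pref_iff:
  "b \<in> schools I \<Longrightarrow> x \<in> with_outside (students I) \<Longrightarrow> y \<in> with_outside (students I) \<Longrightarrow>
    (x, y) \<in> school_pref I b \<longleftrightarrow> spos b x < spos b y"
  by (simp add: pref_position_less_iff[OF school_order])

lemma pos_eq_iff:
  "a \<in> students I \<Longrightarrow> x \<in> with_outside (schools I) \<Longrightarrow> y \<in> with_outside (schools I) \<Longrightarrow>
    pos a x = pos a y \<longleftrightarrow> x = y"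
  by (simp add: inj_on_eq_iff[OF pref_position_inj_on[OF student_order]])

lemma spos_eq_iff:
  "b \<in> schools I \<Longrightarrow> x \<in> with_outside (students I) \<Longrightarrow> y \<in> with_outside (students I) \<Longrightarrow>
    spos b x = spos b y \<longleftrightarrow> x = y"
  by (simp add: inj_on_eq_iff[OF pref_position_inj_on[OF school_order]])

lemma pos_surj:
  assumes "a \<in> students I" "k \<le> pos a None"
  obtains y where "y \<in> with_outside (schools I)" "pos a y = k"
proof -
  let ?X = "with_outside (schools I)"
  have im: "pos a ` ?X = {..<card ?X}"
    by (rule pref_position_image) (use assms(1) student_order in auto)
  have "pos a None \<in> pos a ` ?X" by simp
  then have "k \<in> pos a ` ?X" unfolding im using assms(2) by simp
  then show thesis using that by blast
qed

sublocale sibling_market "students I" "schools I" "\<lambda>a b. pos a (Some b)" "\<lambda>a. pos a None"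
  "\<lambda>b a. spos b (Some a)" "\<lambda>b. spos b None" "quota I" "siblings I"
proof
  fix a k assume "a \<in> students I" "k < pos a None"
  moreover from this obtain y where "y \<in> with_outside (schools I)" "pos a y = k"
    using pos_surj[of a k] by auto
  ultimately show "\<exists>b\<in>schools I. pos a (Some b) = k" by (cases y) auto
qed (use finite_sets mssp in \<open>auto simp: inj_on_def pos_eq_iff spos_eq_iff mssp_instance_def\<close>)

lemma acceptable_class:
  assumes "a \<in> students I" "c \<in> activities I"
  shows "acceptable_class I a c \<in> activity_classes I c"
    "(Some (acceptable_class I a c), None) \<in> student_pref I a"
    "acceptable_class I a c \<in> schools I"
proof -
  have "\<exists>!b. b \<in> activity_classes I c \<and> (Some b, None) \<in> student_pref I a"
    using assms mssp by (auto simp: mssp_instance_def)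
  from theI'[OF this] show 1: "acceptable_class I a c \<in> activity_classes I c"
    "(Some (acceptable_class I a c), None) \<in> student_pref I a"
    by (auto simp: acceptable_class_def)
  have "(\<Union>c\<in>activities I. activity_classes I c) = schools I" using mssp by (simp add: mssp_instance_def)
  then show "acceptable_class I a c \<in> schools I" using 1(1) assms(2) by blast
qed

lemma acceptable_class_eqI:
  assumes "a \<in> students I" "c \<in> activities I" "b \<in> activity_classes I c" "pos a (Some b) < pos a None"
  shows "b = acceptable_class I a c"
proof -
  have ex1: "\<exists>!b. b \<in> activity_classes I c \<and> (Some b, None) \<in> student_pref I a"
    using assms mssp by (auto simp: mssp_instance_def)
  have "(\<Union>c\<in>activities I. activity_classes I c) = schools I" using mssp by (simp add: mssp_instance_def)
  then have "b \<in> schools I" using assms by blast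
  then have "(Some b, None) \<in> student_pref I a" using assms by (simp add: student_pref_iff)
  then show ?thesis using ex1 acceptable_class[OF assms(1,2)] assms(3) by blast
qed

lemma acceptable_class_inj:
  assumes "a \<in> students I"
  shows "inj_on (acceptable_class I a) (activities I)"
proof (rule inj_onI)
  fix c c' assume "c \<in> activities I" "c' \<in> activities I" "acceptable_class I a c = acceptable_class I a c'"
  moreover have "disjoint_family_on (activity_classes I) (activities I)"
    using mssp by (simp add: mssp_instance_def)
  ultimately show "c = c'"
    using acceptable_class(1)[OF assms, of c] acceptable_class(1)[OF assms, of c']
    by (auto simp: disjoint_family_on_def)
qed

text \<open>
  Only acceptable classes precede an acceptable class, and there is one of them per activity, so
  its position counts the preferred activities.
\<close>

lemma pos_acceptable_class:
  assumes a: "a \<in> students I" and c: "c \<in> activities I"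
  shows "pos a (Some (acceptable_class I a c)) =
    card {c'\<in>activities I.
      (Some (acceptable_class I a c'), Some (acceptable_class I a c)) \<in> student_pref I a}"
    (is "_ = card ?C")
proof -
  let ?b = "acceptable_class I a c"
  have r: "student_pref I a \<subseteq> with_outside (schools I) \<times> with_outside (schools I)"
    using student_order[OF a] by (simp add: strict_total_order_def)
  have "{y. (y, Some ?b) \<in> student_pref I a} = (\<lambda>c'. Some (acceptable_class I a c')) ` ?C"
  proof (intro equalityI subsetI)
    fix y assume "y \<in> {y. (y, Some ?b) \<in> student_pref I a}"
    then have y: "(y, Some ?b) \<in> student_pref I a" "y \<in> with_outside (schools I)" using r by auto
    have lt: "pos a y < pos a None"
      using y acceptable_class[OF a c] a by (auto simp: student_pref_iff)
    then obtain b where b: "y = Some b" by (cases y) auto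
    have "(\<Union>c\<in>activities I. activity_classes I c) = schools I" using mssp by (simp add: mssp_instance_def)
    then obtain c' where "c' \<in> activities I" "b \<in> activity_classes I c'" using y b by auto
    then show "y \<in> (\<lambda>c'. Some (acceptable_class I a c')) ` ?C"
      using acceptable_class_eqI[OF a, of c' b] y lt b by auto
  qed auto
  moreover have "inj_on (\<lambda>c'. Some (acceptable_class I a c')) ?C"
    using acceptable_class_inj[OF a] by (auto simp: inj_on_def)
  ultimately show ?thesis by (simp add: pref_position_def card_image)
qed

text \<open>Siblings rank the activities alike, so the sets counted in
  \<open>pos_acceptable_class\<close> coincide for both.\<close>

lemma sibling_pos_eq:
  assumes "(a, a') \<in> siblings I" "c \<in> activities I"
  shows "pos a (Some (acceptable_class I a c)) = pos a' (Some (acceptable_class I a' c))"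
proof -
  have "a \<in> students I" "a' \<in> students I" using assms mssp by (auto simp: mssp_instance_def)
  moreover have "(Some (acceptable_class I a c'), Some (acceptable_class I a c)) \<in> student_pref I a \<longleftrightarrow>
      (Some (acceptable_class I a' c'), Some (acceptable_class I a' c)) \<in> student_pref I a'"
    if "c' \<in> activities I" for c'
    using that mssp assms unfolding mssp_instance_def by blast
  ultimately show ?thesis
    using assms(2) by (simp add: pos_acceptable_class cong: conj_cong)
qed

section \<open>Matchings and their position vectors\<close>

context
  fixes M assumes M: "matching I M"
begin

lemma partner_of_student_iff:
  "a \<in> students I \<Longrightarrow> (Some a, y) \<in> M \<longleftrightarrow> partner_of_student M a = y"
proof -
  assume "a \<in> students I"
  then have ex1: "\<exists>!y. (Some a, y) \<in> M" using M by (auto simp: matching_def)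
  show ?thesis
    unfolding partner_of_student_def using theI'[OF ex1] the1_equality[OF ex1] by blast
qed

lemma partner_in_outside: "a \<in> students I \<Longrightarrow> partner_of_student M a \<in> with_outside (schools I)"
  using M partner_of_student_iff[of a "partner_of_student M a"] by (auto simp: matching_def)

lemma partners_of_school_eq:
  assumes "b \<in> schools I"
  shows "partners_of_school M b - {None} = Some ` seats (\<lambda>a. pos a (partner_of_student M a)) b"
proof -
  have "x \<in> students I" if "(Some x, Some b) \<in> M" for x
    using that M by (auto simp: matching_def)
  moreover have "(Some a, Some b) \<in> M \<longleftrightarrow> a \<in> seats (\<lambda>a. pos a (partner_of_student M a)) b"
    if "a \<in> students I" for a
    using that assms partner_in_outside[OF that]
    by (auto simp: seats_def partner_of_student_iff pos_eq_iff)
  ultimately show ?thesis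
    by (auto simp: partners_of_school_def seats_def image_iff) (metis not_None_eq)
qed

text \<open>In \<open>matching\<close>, the outside option is a partner precisely in the case of
  fewer than \<open>quota I b\<close> students; it stands for the vacancies.\<close>

lemma school_capacity:
  assumes "b \<in> schools I"
  shows "card (seats (\<lambda>a. pos a (partner_of_student M a)) b) \<le> quota I b"
    "None \<in> partners_of_school M b \<longleftrightarrow>
      card (seats (\<lambda>a. pos a (partner_of_student M a)) b) < quota I b"
proof -
  have card: "card (partners_of_school M b - {None}) =
      card (seats (\<lambda>a. pos a (partner_of_student M a)) b)"
    unfolding partners_of_school_eq[OF assms] by (rule card_image) simp
  have "None \<notin> partners_of_school M b \<and> card (partners_of_school M b) = quota I b \<or>
      None \<in> partners_of_school M b \<and> card (partners_of_school M b - {None}) < quota I b"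
    using M assms by (auto simp: matching_def)
  then show "card (seats (\<lambda>a. pos a (partner_of_student M a)) b) \<le> quota I b"
    "None \<in> partners_of_school M b \<longleftrightarrow>
      card (seats (\<lambda>a. pos a (partner_of_student M a)) b) < quota I b"
    unfolding card[symmetric] by auto
qed

text \<open>A partner \<open>Some a'\<close> in a blocking pair is an occupant and a partner
  \<open>None\<close> a vacancy; these give the two conditions on envy in \<open>stable_at\<close>.
  An envious student is no occupant, so the negated comparison of positions is again strict.\<close>

lemma stable_matching_iff_stable_at:
  "stable_matching I M \<longleftrightarrow> stable_at (\<lambda>a. pos a (partner_of_student M a))" (is "_ \<longleftrightarrow> stable_at ?c")
proof -
  have rational: "\<not> (\<exists>a\<in>students I. (None, partner_of_student M a) \<in> student_pref I a) \<longleftrightarrow>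
      (\<forall>a\<in>students I. ?c a \<le> pos a None)"
    by (auto simp: student_pref_iff partner_in_outside not_less)
  have partner: "x \<in> partners_of_school M b \<longleftrightarrow>
      (case x of None \<Rightarrow> card (seats ?c b) < quota I b | Some a \<Rightarrow> a \<in> seats ?c b)"
    if "b \<in> schools I" for x b
    using partners_of_school_eq[OF that] school_capacity(2)[OF that] by (cases x) auto
  have seat: "a \<in> students I" if "a \<in> seats ?c b" for a b using that by (simp add: seats_def)
  have block: "(\<exists>x\<in>partners_of_school M b. (Some a, x) \<in> school_pref I b) \<longleftrightarrow>
      \<not> ((\<forall>a'\<in>seats ?c b. spos b (Some a') < spos b (Some a)) \<and>
         (card (seats ?c b) < quota I b \<longrightarrow> spos b None < spos b (Some a)))"
    if b: "b \<in> schools I" and a: "a \<in> students I" "pos a (Some b) < ?c a" for a b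
  proof -
    have "(Some a, Some a') \<in> school_pref I b \<longleftrightarrow> \<not> spos b (Some a') < spos b (Some a)"
      if a': "a' \<in> seats ?c b" for a'
    proof -
      have "a \<noteq> a'" using a a' by (auto simp: seats_def)
      then have "spos b (Some a) \<noteq> spos b (Some a')" using a b seat[OF a'] by (simp add: spos_eq_iff)
      then show ?thesis using a b seat[OF a'] by (auto simp: school_pref_iff)
    qed
    moreover have "(Some a, None) \<in> school_pref I b \<longleftrightarrow> \<not> spos b None < spos b (Some a)"
      using spos_eq_iff[of b "Some a" None] a b by (auto simp: school_pref_iff)
    ultimately show ?thesis
      unfolding Bex_def split_option_ex by (auto simp: partner[OF b])
  qed
  have outside: "(\<exists>x\<in>partners_of_school M b. (None, x) \<in> school_pref I b) \<longleftrightarrow>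
      \<not> (\<forall>a\<in>seats ?c b. spos b (Some a) < spos b None)" if b: "b \<in> schools I" for b
  proof -
    have "(None, Some a) \<in> school_pref I b \<longleftrightarrow> \<not> spos b (Some a) < spos b None" if "a \<in> seats ?c b" for a
      using spos_eq_iff[of b "Some a" None] b seat[OF that] by (auto simp: school_pref_iff)
    moreover have "(None, None) \<notin> school_pref I b" using b by (simp add: school_pref_iff)
    ultimately show ?thesis
      unfolding Bex_def split_option_ex by (auto simp: partner[OF b])
  qed
  have wants: "(Some b, partner_of_student M a) \<in> student_pref I a \<longleftrightarrow> pos a (Some b) < ?c a"
    if "a \<in> students I" "b \<in> schools I" for a b
    using that by (simp add: student_pref_iff partner_in_outside)
  have "(\<exists>a\<in>students I. \<exists>b\<in>schools I.
        (Some b, partner_of_student M a) \<in> student_pref I a \<and>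
        (\<exists>x\<in>partners_of_school M b. (Some a, x) \<in> school_pref I b)) \<longleftrightarrow>
      \<not> (\<forall>b\<in>schools I. \<forall>a\<in>students I. pos a (Some b) < ?c a \<longrightarrow>
        (\<forall>a'\<in>seats ?c b. spos b (Some a') < spos b (Some a)) \<and>
         (card (seats ?c b) < quota I b \<longrightarrow> spos b None < spos b (Some a)))"
    using wants block by blast
  moreover have "(\<exists>b\<in>schools I. \<exists>x\<in>partners_of_school M b. (None, x) \<in> school_pref I b) \<longleftrightarrow>
      \<not> (\<forall>b\<in>schools I. \<forall>a\<in>seats ?c b. spos b (Some a) < spos b None)"
    using outside by blast
  ultimately show ?thesis
    unfolding stable_matching_def stable_at_def rational
    using M school_capacity(1) by blast
qed

end

lemma matching_of_positions:
  assumes c: "stable_at c"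
  obtains M where "matching I M" "\<And>a. a \<in> students I \<Longrightarrow> pos a (partner_of_student M a) = c a"
proof
  \<comment> \<open>A class with vacancies is paired with the outside option, as the definition of
    \<open>matching\<close> demands.\<close>
  define M where "M = {(Some a, y) | a y. a \<in> students I \<and> y \<in> with_outside (schools I) \<and> pos a y = c a} \<union>
    {(None, Some b) | b. b \<in> schools I \<and> card (seats c b) < quota I b}"
  have ex1: "\<exists>!y. (Some a, y) \<in> M" if a: "a \<in> students I" for a
  proof -
    have "c a \<le> pos a None" using c a by (simp add: stable_at_def)
    then obtain y where "y \<in> with_outside (schools I)" "pos a y = c a" using pos_surj[OF a] by blast
    then show ?thesis using a by (intro ex1I[of _ y]) (auto simp: M_def pos_eq_iff[symmetric])
  qed
  have partners: "partners_of_school M b - {None} = Some ` seats c b"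
    "None \<in> partners_of_school M b \<longleftrightarrow> card (seats c b) < quota I b" if "b \<in> schools I" for b
    using that by (auto simp: partners_of_school_def M_def seats_def)
  have "None \<notin> partners_of_school M b \<and> card (partners_of_school M b) = quota I b \<or>
      None \<in> partners_of_school M b \<and> card (partners_of_school M b - {None}) < quota I b"
    if b: "b \<in> schools I" for b
  proof -
    have "card (partners_of_school M b - {None}) = card (seats c b)"
      unfolding partners(1)[OF b] by (rule card_image) simp
    moreover have "card (seats c b) \<le> quota I b" using c b by (simp add: stable_at_def)
    ultimately show ?thesis using partners(2)[OF b] by (cases "None \<in> partners_of_school M b") auto
  qed
  then show matching: "matching I M"
    unfolding matching_def using ex1 by (auto simp: M_def)
  show "pos a (partner_of_student M a) = c a" if a: "a \<in> students I" for a
    using partner_of_student_iff[OF matching a, of "partner_of_student M a"] by (simp add: M_def)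
qed

text \<open>Stability puts an assigned class before the outside option, so it is the acceptable
  class of its activity. A common activity then gives equal positions by
  \<open>sibling_pos_eq\<close>, and conversely equal positions identify the two activities.\<close>

lemma partner_same_activity_iff:
  assumes st: "stable_matching I M" and sib: "(a, a') \<in> siblings I"
  shows "(\<exists>c\<in>activities I. \<exists>b\<in>activity_classes I c. \<exists>b'\<in>activity_classes I c.
      partner_of_student M a = Some b \<and> partner_of_student M a' = Some b') \<longleftrightarrow>
    pos a (partner_of_student M a) = pos a' (partner_of_student M a') \<and>
    pos a (partner_of_student M a) < pos a None \<and> pos a' (partner_of_student M a') < pos a' None"
    (is "?L \<longleftrightarrow> ?R")
proof
  have M: "matching I M" using st by (simp add: stable_matching_def)
  have in_students: "a \<in> students I" "a' \<in> students I" using sib S_subset by auto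
  have classes: "(\<Union>c\<in>activities I. activity_classes I c) = schools I"
    using mssp by (simp add: mssp_instance_def)
  have matched: "pos x (Some b) < pos x None"
    if "x \<in> students I" "partner_of_student M x = Some b" for x b
  proof -
    have "pos x (Some b) \<le> pos x None"
      using st that by (auto simp: stable_matching_iff_stable_at[OF M] stable_at_def)
    moreover have "b \<in> schools I" using partner_in_outside[OF M that(1)] that(2) by simp
    ultimately show ?thesis using pos_eq_iff[OF that(1), of "Some b" None] by auto
  qed
  {
    assume ?L
    then obtain c b b' where c: "c \<in> activities I" "b \<in> activity_classes I c" "b' \<in> activity_classes I c"
      and partners: "partner_of_student M a = Some b" "partner_of_student M a' = Some b'" by blast
    have "b = acceptable_class I a c" "b' = acceptable_class I a' c"
      using c in_students matched partners by (auto intro: acceptable_class_eqI)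
    then show ?R
      using partners matched[OF in_students(1)] matched[OF in_students(2)] sibling_pos_eq[OF sib c(1)]
      by auto
  }
  assume R: ?R
  have "\<exists>c\<in>activities I. partner_of_student M x = Some (acceptable_class I x c)"
    if x: "x \<in> students I" "pos x (partner_of_student M x) < pos x None" for x
  proof -
    obtain b where b: "partner_of_student M x = Some b" using x(2) by (cases "partner_of_student M x") auto
    then have "b \<in> schools I" using partner_in_outside[OF M x(1)] by simp
    then obtain c where "c \<in> activities I" "b \<in> activity_classes I c" using classes by auto
    then show ?thesis using acceptable_class_eqI[OF x(1), of c b] x(2) b by auto
  qed
  then obtain c c' where c: "c \<in> activities I" "partner_of_student M a = Some (acceptable_class I a c)"
    "c' \<in> activities I" "partner_of_student M a' = Some (acceptable_class I a' c')"
    using R in_students by meson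
  \<comment> \<open>The class acceptable to \<open>a'\<close> in the activity of \<open>a\<close>
    has the same position as the class that \<open>a'\<close> attends, and a list has one class per
    position.\<close>
  have "pos a' (Some (acceptable_class I a' c')) = pos a' (Some (acceptable_class I a' c))"
    using R c sibling_pos_eq[OF sib c(1)] by simp
  then have "acceptable_class I a' c' = acceptable_class I a' c"
    using acceptable_class(3) c in_students by (simp add: pos_eq_iff)
  then show ?L using acceptable_class(1)[OF in_students(1) c(1)] acceptable_class(1)[OF in_students(2) c(1)] c
    by auto
qed

lemma activity_stable_iff:
  assumes M: "matching I M"
  shows "activity_stable I M \<longleftrightarrow> stable_at (\<lambda>a. pos a (partner_of_student M a)) \<and>
    siblings_agree (\<lambda>a. pos a (partner_of_student M a))"
  unfolding activity_stable_def siblings_agree_def stable_matching_iff_stable_at[OF M, symmetric]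
  using partner_same_activity_iff[of M] by blast

lemma activity_stable_solvable_iff:
  "(\<exists>M. activity_stable I M) \<longleftrightarrow> (\<exists>c. stable_at c \<and> siblings_agree c)"
proof
  assume "\<exists>M. activity_stable I M"
  then obtain M where M: "activity_stable I M" ..
  then have "matching I M" by (simp add: activity_stable_def stable_matching_def)
  then show "\<exists>c. stable_at c \<and> siblings_agree c" using M activity_stable_iff by blast
next
  assume "\<exists>c. stable_at c \<and> siblings_agree c"
  then obtain c where c: "stable_at c" "siblings_agree c" by blast
  then obtain M where M: "matching I M"
    and eq: "\<And>a. a \<in> students I \<Longrightarrow> pos a (partner_of_student M a) = c a"
    using matching_of_positions by blast
  \<comment> \<open>The two vectors agree on students only, but \<open>seats\<close> and the
    conditions on solutions look at nothing else.\<close>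
  have seats_eq: "seats (\<lambda>a. pos a (partner_of_student M a)) = seats c"
    using eq by (auto simp: seats_def fun_eq_iff)
  have "stable_at (\<lambda>a. pos a (partner_of_student M a))"
    using c(1) by (simp add: stable_at_def seats_eq eq)
  moreover have "siblings_agree (\<lambda>a. pos a (partner_of_student M a))"
    using c(2) S_subset eq by (fastforce simp: siblings_agree_def)
  ultimately show "\<exists>M. activity_stable I M" using activity_stable_iff[OF M] by blast
qed

end

section \<open>Compiling expressions for the random access machine\<close>

text \<open>The exponential loss is harmless, as every number that the program handles is itself
  polynomial in the length of the input.\<close>

lemma digits_le: "digits n \<le> Suc n"
proof -
  have "floorlog 2 n \<le> n" by (rule floorlog_leI) (auto simp: less_exp)
  then show ?thesis by (simp add: digits_def)
qed

section \<open>Functions bounded by polynomials\<close>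

lemma poly_mono_nat: "x \<le> y \<Longrightarrow> poly f x \<le> poly f y" for f :: "nat poly"
  by (induction f) (auto intro: add_mono mult_mono)

definition poly_bounded :: "(nat \<Rightarrow> nat) \<Rightarrow> bool" where
  "poly_bounded f \<longleftrightarrow> (\<exists>g :: nat poly. \<forall>x. f x \<le> poly g x)"

lemma poly_bounded_const: "poly_bounded (\<lambda>_. c)"
  unfolding poly_bounded_def by (rule exI[of _ "[:c:]"]) simp

lemma poly_bounded_id: "poly_bounded (\<lambda>x. x)"
  unfolding poly_bounded_def by (rule exI[of _ "[:0, 1:]"]) simp

lemma poly_bounded_add:
  assumes "poly_bounded f" "poly_bounded g" shows "poly_bounded (\<lambda>x. f x + g x)"
proof -
  from assms obtain F G where "\<forall>x. f x \<le> poly F x" "\<forall>x. g x \<le> poly G x"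
    unfolding poly_bounded_def by auto
  then have "\<forall>x. f x + g x \<le> poly (F + G) x" by (simp add: add_mono)
  then show ?thesis unfolding poly_bounded_def by blast
qed

lemma poly_bounded_mult:
  assumes "poly_bounded f" "poly_bounded g" shows "poly_bounded (\<lambda>x. f x * g x)"
proof -
  from assms obtain F G where "\<forall>x. f x \<le> poly F x" "\<forall>x. g x \<le> poly G x"
    unfolding poly_bounded_def by auto
  then have "\<forall>x. f x * g x \<le> poly (F * G) x" by (simp add: mult_mono)
  then show ?thesis unfolding poly_bounded_def by blast
qed

lemma poly_bounded_Suc: "poly_bounded f \<Longrightarrow> poly_bounded (\<lambda>x. Suc (f x))"
  using poly_bounded_add[of f "\<lambda>_. 1"] poly_bounded_const[of 1] by simp

text \<open>Natural coefficients make the outer polynomial monotone, so it may be applied to the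
  bound for the inner function.\<close>

lemma poly_bounded_compose:
  assumes "poly_bounded f" "poly_bounded g" shows "poly_bounded (\<lambda>x. f (g x))"
proof -
  from assms obtain F G where "\<forall>x. f x \<le> poly F x" "\<forall>x. g x \<le> poly G x"
    unfolding poly_bounded_def by auto
  then have "\<forall>x. f (g x) \<le> poly (pcompose F G) x"
    by (metis poly_pcompose poly_mono_nat order_trans)
  then show ?thesis unfolding poly_bounded_def by blast
qed

lemmas poly_bounded_intros =
  poly_bounded_const poly_bounded_id poly_bounded_add poly_bounded_mult poly_bounded_Suc

text \<open>
  Variables are de Bruijn indices, bound by \<open>SumUp\<close>; \<open>Cell\<close> reads the memory.
\<close>

datatype expr =
    Num nat
  | Var nat
  | Plus expr expr
  | Minus expr expr
  | Cell expr
  | SumUp expr expr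

primrec eval :: "expr \<Rightarrow> (nat \<Rightarrow> nat) \<Rightarrow> (nat \<Rightarrow> nat) \<Rightarrow> nat" where
  "eval (Num n) \<rho> m = n"
| "eval (Var i) \<rho> m = \<rho> i"
| "eval (Plus e f) \<rho> m = eval e \<rho> m + eval f \<rho> m"
| "eval (Minus e f) \<rho> m = eval e \<rho> m - eval f \<rho> m"
| "eval (Cell e) \<rho> m = m (eval e \<rho> m)"
| "eval (SumUp e f) \<rho> m = (\<Sum>i<eval e \<rho> m. eval f (case_nat i \<rho>) m)"

text \<open>
  The loop counts register \<open>d\<close> down to 0 and register \<open>d + 1\<close> up from 0, using register
  \<open>d + 3\<close> as a scratch cell.
\<close>

definition loop :: "nat \<Rightarrow> ram \<Rightarrow> ram" where
  "loop d body = Seq (Const (d + 1) 0) (WhileNZ d (Seq body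
     (Seq (Const (d + 3) 1) (Seq (Add (d + 1) (d + 1) (d + 3)) (Sub d d (d + 3))))))"

text \<open>Variable \<open>i\<close> lives in register \<open>\<sigma> i < d\<close>; the result is left in register \<open>d\<close>.\<close>

primrec compile :: "expr \<Rightarrow> (nat \<Rightarrow> nat) \<Rightarrow> nat \<Rightarrow> ram" where
  "compile (Num n) \<sigma> d = Const d n"
| "compile (Var i) \<sigma> d = Seq (Const d 0) (Add d d (\<sigma> i))"
| "compile (Plus e f) \<sigma> d = Seq (compile e \<sigma> d) (Seq (compile f \<sigma> (d + 1)) (Add d d (d + 1)))"
| "compile (Minus e f) \<sigma> d = Seq (compile e \<sigma> d) (Seq (compile f \<sigma> (d + 1)) (Sub d d (d + 1)))"
| "compile (Cell e) \<sigma> d = Seq (compile e \<sigma> d) (Load d d)"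
| "compile (SumUp e f) \<sigma> d =
     Seq (compile e \<sigma> d) (Seq (Const (d + 2) 0)
       (Seq (loop d (Seq (compile f (case_nat (d + 1) \<sigma>) (d + 3)) (Add (d + 2) (d + 2) (d + 3))))
         (Add d d (d + 2))))"

text \<open>\<open>V\<close> bounds all variables and memory cells. Under \<open>SumUp\<close> a
  variable below the value of \<open>e\<close> joins them, hence the enlarged bound for
  \<open>f\<close>.\<close>

primrec value_bound :: "expr \<Rightarrow> nat \<Rightarrow> nat" where
  "value_bound (Num n) V = n"
| "value_bound (Var i) V = V"
| "value_bound (Plus e f) V = value_bound e V + value_bound f V"
| "value_bound (Minus e f) V = value_bound e V"
| "value_bound (Cell e) V = V"
| "value_bound (SumUp e f) V = value_bound e V * value_bound f (V + value_bound e V)"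

text \<open>Rounded up: besides its body an iteration costs at most \<open>3 * k + 8\<close>, for
  the loop test and for counters with values up to \<open>k\<close>.\<close>

definition loop_time :: "nat \<Rightarrow> nat \<Rightarrow> nat" where
  "loop_time k t = k * (t + 5 * k + 10) + 5"

primrec time_bound :: "expr \<Rightarrow> nat \<Rightarrow> nat" where
  "time_bound (Num n) V = n + 1"
| "time_bound (Var i) V = V + 5"
| "time_bound (Plus e f) V = time_bound e V + time_bound f V + value_bound e V + value_bound f V + 2"
| "time_bound (Minus e f) V = time_bound e V + time_bound f V + value_bound e V + value_bound f V + 2"
| "time_bound (Cell e) V = time_bound e V + value_bound e V + V + 2"
| "time_bound (SumUp e f) V = time_bound e V + 1 +
     loop_time (value_bound e V)
       (time_bound f (V + value_bound e V) + value_bound (SumUp e f) V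
         + value_bound f (V + value_bound e V) + 2)
     + value_bound (SumUp e f) V + 5"

lemma poly_bounded_value_bound: "poly_bounded (value_bound e)"
proof (induction e)
  case (SumUp e f)
  have "poly_bounded (\<lambda>x. x + value_bound e x)"
    using SumUp by (simp add: poly_bounded_intros)
  from poly_bounded_compose[OF SumUp.IH(2) this] SumUp.IH(1) show ?case
    by (simp add: poly_bounded_intros)
qed (simp_all add: poly_bounded_intros)

lemma poly_bounded_loop_time:
  "poly_bounded f \<Longrightarrow> poly_bounded g \<Longrightarrow> poly_bounded (\<lambda>x. loop_time (f x) (g x))"
  by (simp add: loop_time_def poly_bounded_intros)

lemma poly_bounded_time_bound: "poly_bounded (time_bound e)"
proof (induction e)
  case (SumUp e f)
  have W: "poly_bounded (\<lambda>x. x + value_bound e x)"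
    by (simp add: poly_bounded_intros poly_bounded_value_bound)
  from poly_bounded_compose[OF SumUp.IH(2) W] SumUp.IH(1)
    poly_bounded_compose[OF poly_bounded_value_bound[of f] W]
  show ?case
    by (simp add: poly_bounded_intros poly_bounded_loop_time poly_bounded_value_bound)
qed (simp_all add: poly_bounded_intros poly_bounded_value_bound)

lemma eval_le_value_bound:
  assumes "\<And>i. \<rho> i \<le> V" "\<And>i. m i \<le> V"
  shows "eval e \<rho> m \<le> value_bound e V"
  using assms
proof (induction e arbitrary: \<rho> V)
  case (Plus e f)
  have "eval e \<rho> m \<le> value_bound e V" by (rule Plus.IH(1); fact Plus.prems)
  moreover have "eval f \<rho> m \<le> value_bound f V" by (rule Plus.IH(2); fact Plus.prems)
  ultimately show ?case by simp
next
  case (Minus e f)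
  have "eval e \<rho> m \<le> value_bound e V" by (rule Minus.IH(1); fact Minus.prems)
  then show ?case by simp
next
  case (SumUp e f)
  have k: "eval e \<rho> m \<le> value_bound e V" by (rule SumUp.IH(1); fact SumUp.prems)
  have "eval f (case_nat i \<rho>) m \<le> value_bound f (V + value_bound e V)" if "i < eval e \<rho> m" for i
  proof (rule SumUp.IH(2))
    show "case_nat i \<rho> j \<le> V + value_bound e V" for j
      using k that SumUp.prems(1) by (cases j) (simp_all add: trans_le_add1)
    show "m j \<le> V + value_bound e V" for j
      using SumUp.prems(2) by (simp add: trans_le_add1)
  qed
  then have "eval (SumUp e f) \<rho> m \<le> (\<Sum>i<eval e \<rho> m. value_bound f (V + value_bound e V))"
    unfolding eval.simps by (intro sum_mono) simp
  also have "\<dots> \<le> value_bound (SumUp e f) V" using k by simp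
  finally show ?case .
qed simp_all

section \<open>Total correctness with a time budget\<close>

definition runs_within :: "ram \<Rightarrow> state \<Rightarrow> nat \<Rightarrow> (state \<Rightarrow> bool) \<Rightarrow> bool" where
  "runs_within p s T P \<longleftrightarrow> (\<exists>t s'. exec p s t s' \<and> t \<le> T \<and> P s')"

lemma runs_within_Seq:
  assumes "runs_within p s T P" "\<And>s'. P s' \<Longrightarrow> runs_within q s' T' R" "T + T' \<le> U"
  shows "runs_within (Seq p q) s U R"
  using assms unfolding runs_within_def by (meson exec.Seq add_mono order_trans)

lemma runs_within_weaken:
  assumes "runs_within p s T P" "T \<le> T'" "\<And>s'. P s' \<Longrightarrow> R s'"
  shows "runs_within p s T' R"
  using assms unfolding runs_within_def by (meson order_trans)

lemma runs_within_step:
  "exec p s t s' \<Longrightarrow> t \<le> T \<Longrightarrow> P s' \<Longrightarrow> runs_within p s T P"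
  unfolding runs_within_def by blast

lemma runs_within_Const:
  "n + 1 \<le> T \<Longrightarrow> P (r(i := n), m) \<Longrightarrow> runs_within (Const i n) (r, m) T P"
  by (rule runs_within_step[OF exec.Const]) (use digits_le[of n] in auto)

lemma runs_within_Const_Seq:
  assumes "runs_within p (r(i := n), m) T P" "n + 1 + T \<le> U"
  shows "runs_within (Seq (Const i n) p) (r, m) U P"
proof (rule runs_within_Seq)
  show "runs_within (Const i n) (r, m) (n + 1) (\<lambda>s. s = (r(i := n), m))"
    by (rule runs_within_Const) simp_all
  show "runs_within p s' T P" if "s' = (r(i := n), m)" for s'
    using assms(1) that by simp
qed (fact assms(2))

lemma runs_within_Add:
  "r j + r k + 2 \<le> T \<Longrightarrow> P (r(i := r j + r k), m) \<Longrightarrow> runs_within (Add i j k) (r, m) T P"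
  by (rule runs_within_step[OF exec.Add]) (use digits_le[of "r j"] digits_le[of "r k"] in auto)

lemma runs_within_Sub:
  "r j + r k + 2 \<le> T \<Longrightarrow> P (r(i := r j - r k), m) \<Longrightarrow> runs_within (Sub i j k) (r, m) T P"
  by (rule runs_within_step[OF exec.Sub]) (use digits_le[of "r j"] digits_le[of "r k"] in auto)

lemma runs_within_Load:
  "r j + m (r j) + 2 \<le> T \<Longrightarrow> P (r(i := m (r j)), m) \<Longrightarrow> runs_within (Load i j) (r, m) T P"
  by (rule runs_within_step[OF exec.Load]) (use digits_le[of "r j"] digits_le[of "m (r j)"] in auto)

lemma runs_within_Store:
  "r i + r j + 2 \<le> T \<Longrightarrow> P (r, m(r i := r j)) \<Longrightarrow> runs_within (Store i j) (r, m) T P"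
  by (rule runs_within_step[OF exec.Store]) (use digits_le[of "r i"] digits_le[of "r j"] in auto)

text \<open>Induction on the number \<open>j\<close> of remaining rounds; the index of
  \<open>J\<close> is the number of completed ones, hence the start at \<open>k - j\<close>.\<close>

lemma runs_within_While:
  assumes "\<And>i r m. i < k \<Longrightarrow> J i r m \<Longrightarrow> r d = k - i \<and>
      runs_within body (r, m) T (\<lambda>(r', m'). J (Suc i) r' m')"
    and "\<And>r m. J k r m \<Longrightarrow> r d = 0"
  shows "j \<le> k \<Longrightarrow> J (k - j) r m \<Longrightarrow> 
    runs_within (WhileNZ d body) (r, m) (j * (T + k + 1) + 1) (\<lambda>(r', m'). J k r' m')"
proof (induction j arbitrary: r m)
  case 0
  then have "r d = 0" using assms(2) by simp
  then have "exec (WhileNZ d body) (r, m) (digits 0) (r, m)" using exec.WhileFalse by metis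
  then show ?case using 0 digits_le[of 0] unfolding runs_within_def by fastforce
next
  case (Suc j)
  let ?i = "k - Suc j"
  have "?i < k" and S: "Suc ?i = k - j" using Suc.prems by auto
  then have d: "r d = Suc j" and "runs_within body (r, m) T (\<lambda>(r', m'). J (k - j) r' m')"
    using assms(1)[of ?i r m] Suc.prems by auto
  then obtain t r1 m1 where 1: "exec body (r, m) t (r1, m1)" "t \<le> T" "J (k - j) r1 m1"
    unfolding runs_within_def by auto
  from Suc.IH[OF _ 1(3)] Suc.prems(1) obtain u s where 2:
    "exec (WhileNZ d body) (r1, m1) u s" "u \<le> j * (T + k + 1) + 1" "case s of (r', m') \<Rightarrow> J k r' m'"
    unfolding runs_within_def by auto
  have "exec (WhileNZ d body) (r, m) (digits (r d) + t + u) s"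
    using 1(1) 2(1) d by (intro exec.WhileTrue) auto
  moreover have "digits (r d) \<le> k + 1" using digits_le[of "r d"] d Suc.prems by simp
  ultimately show ?case using 1 2 unfolding runs_within_def by fastforce
qed

text \<open>The invariant must survive the bookkeeping, which overwrites both counters and the
  scratch register. The body may use the scratch register but has to hand back the counters
  unchanged.\<close>

lemma runs_within_loop:
  assumes body: "\<And>i r m. i < k \<Longrightarrow> J i r m \<Longrightarrow> r d = k - i \<Longrightarrow> r (d + 1) = i \<Longrightarrow>
      runs_within body (r, m) T (\<lambda>(r', m'). J (Suc i) r' m' \<and> r' d = r d \<and> r' (d + 1) = r (d + 1))"
    and frame: "\<And>i r m x v. J i r m \<Longrightarrow> x \<in> {d, d + 1, d + 3} \<Longrightarrow> J i (r(x := v)) m"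
    and init: "J 0 r m" "r d = k"
  shows "runs_within (loop d body) (r, m) (loop_time k T) (\<lambda>(r', m'). J k r' m' \<and> r' d = 0)"
proof -
  let ?J = "\<lambda>i r m. J i r m \<and> r d = k - i \<and> r (d + 1) = i"
  let ?body = "Seq body (Seq (Const (d + 3) 1) (Seq (Add (d + 1) (d + 1) (d + 3)) (Sub d d (d + 3))))"
  have step: "runs_within ?body (r, m) (T + 2 * k + 7) (\<lambda>(r', m'). ?J (Suc i) r' m')"
    if i: "i < k" and J: "?J i r m" for i r m
  proof (rule runs_within_Seq[OF body])
    fix s' assume "case s' of (r', m') \<Rightarrow> J (Suc i) r' m' \<and> r' d = r d \<and> r' (d + 1) = r (d + 1)"
    then obtain r' m' where s': "s' = (r', m')" "J (Suc i) r' m'" "r' d = k - i" "r' (d + 1) = i"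
      using J by auto
    show "runs_within (Seq (Const (d + 3) 1) (Seq (Add (d + 1) (d + 1) (d + 3)) (Sub d d (d + 3))))
        s' (2 * k + 7) (\<lambda>(r', m'). ?J (Suc i) r' m')"
      unfolding s'(1)
    proof (rule runs_within_Const_Seq[where T = "2 * k + 5"])
      let ?s = "(r'(d + 3 := 1, d + 1 := Suc i), m')"
      have add: "runs_within (Add (d + 1) (d + 1) (d + 3)) (r'(d + 3 := 1), m') (k + 2) (\<lambda>s. s = ?s)"
        by (rule runs_within_Add) (use i s'(4) in simp_all)
      have "J (Suc i) (r'(d + 3 := 1, d + 1 := Suc i, d := k - Suc i)) m'"
        by (rule frame[OF frame[OF frame[OF s'(2)]]]) simp_all
      then have sub: "runs_within (Sub d d (d + 3)) ?s (k + 3) (\<lambda>(r', m'). ?J (Suc i) r' m')"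
        using i s'(3) by (intro runs_within_Sub) simp_all
      show "runs_within (Seq (Add (d + 1) (d + 1) (d + 3)) (Sub d d (d + 3)))
          (r'(d + 3 := 1), m') (2 * k + 5) (\<lambda>(r', m'). ?J (Suc i) r' m')"
        by (rule runs_within_Seq[OF add, where T' = "k + 3"]) (use sub in simp_all)
    qed simp
  qed (use i J in auto)
  have "runs_within (WhileNZ d ?body) (r(d + 1 := 0), m) (k * ((T + 2 * k + 7) + k + 1) + 1)
      (\<lambda>(r', m'). ?J k r' m')"
    by (rule runs_within_While[where J = ?J]) (use init step frame in auto)
  then have "runs_within (WhileNZ d ?body) (r(d + 1 := 0), m) (k * ((T + 2 * k + 7) + k + 1) + 1)
      (\<lambda>(r', m'). J k r' m' \<and> r' d = 0)"
    by (rule runs_within_weaken) auto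
  then show ?thesis
    unfolding loop_def by (rule runs_within_Const_Seq) (simp add: loop_time_def algebra_simps)
qed

lemma loop_time_mono: "k \<le> k' \<Longrightarrow> t \<le> t' \<Longrightarrow> loop_time k t \<le> loop_time k' t'"
  unfolding loop_time_def by (intro add_mono mult_mono) auto

text \<open>Leaving the registers below \<open>d\<close> alone protects the variables, and also the
  first operand while the second one is evaluated at \<open>d + 1\<close>. Environment and
  \<open>V\<close> vary in the induction because of the binder.\<close>

lemma runs_within_compile:
  assumes "\<And>i. \<sigma> i < d" "\<And>i. r (\<sigma> i) = \<rho> i" "\<And>i. \<rho> i \<le> V" "\<And>i. m i \<le> V"
  shows "runs_within (compile e \<sigma> d) (r, m) (time_bound e V)
    (\<lambda>(r', m'). m' = m \<and> r' d = eval e \<rho> m \<and> (\<forall>i<d. r' i = r i))"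
  using assms
proof (induction e arbitrary: \<sigma> d r \<rho> V)
  case (Num n)
  then show ?case by (auto intro: runs_within_Const)
next
  case (Var i)
  have "r (\<sigma> i) \<le> V" "d \<noteq> \<sigma> i" using Var.prems(1)[of i] Var.prems(2,3) by auto
  then have "runs_within (Add d d (\<sigma> i)) (r(d := 0), m) (V + 2)
      (\<lambda>(r', m'). m' = m \<and> r' d = \<rho> i \<and> (\<forall>i<d. r' i = r i))"
    by (intro runs_within_Add) (simp_all add: Var.prems(2))
  then have "runs_within (Seq (Const d 0) (Add d d (\<sigma> i))) (r, m) (V + 5)
      (\<lambda>(r', m'). m' = m \<and> r' d = \<rho> i \<and> (\<forall>i<d. r' i = r i))"
    by (rule runs_within_Const_Seq) simp
  then show ?case by simp
next
  case (Plus e f)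
  have first: "runs_within (compile e \<sigma> d) (r, m) (time_bound e V)
      (\<lambda>(r', m'). m' = m \<and> r' d = eval e \<rho> m \<and> (\<forall>i<d. r' i = r i))"
    by (rule Plus.IH(1); fact Plus.prems)
  have val: "eval g \<rho> m \<le> value_bound g V" for g
    by (rule eval_le_value_bound; fact Plus.prems)
  show ?case unfolding compile.simps
  proof (rule runs_within_Seq[OF first], clarify)
    fix r1 assume r1: "r1 d = eval e \<rho> m" "\<forall>i<d. r1 i = r i"
    have "runs_within (compile f \<sigma> (d + 1)) (r1, m) (time_bound f V)
        (\<lambda>(r', m'). m' = m \<and> r' (d + 1) = eval f \<rho> m \<and> (\<forall>i<d + 1. r' i = r1 i))"
      using r1(2) by (intro Plus.IH(2)) (simp_all add: Plus.prems less_SucI)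
    then show "runs_within (Seq (compile f \<sigma> (d + 1)) (Add d d (d + 1))) (r1, m)
        (time_bound f V + (value_bound e V + value_bound f V + 2))
        (\<lambda>(r', m'). m' = m \<and> r' d = eval (Plus e f) \<rho> m \<and> (\<forall>i<d. r' i = r i))"
    proof (rule runs_within_Seq, clarify)
      fix r2 assume r2: "r2 (d + 1) = eval f \<rho> m" "\<forall>i<d + 1. r2 i = r1 i"
      then show "runs_within (Add d d (d + 1)) (r2, m) (value_bound e V + value_bound f V + 2)
        (\<lambda>(r', m'). m' = m \<and> r' d = eval (Plus e f) \<rho> m \<and> (\<forall>i<d. r' i = r i))"
        using r1 val[of e] val[of f]
        by (intro runs_within_Add) auto
    qed simp
  qed simp
next
  case (Minus e f)
  have first: "runs_within (compile e \<sigma> d) (r, m) (time_bound e V)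
      (\<lambda>(r', m'). m' = m \<and> r' d = eval e \<rho> m \<and> (\<forall>i<d. r' i = r i))"
    by (rule Minus.IH(1); fact Minus.prems)
  have val: "eval g \<rho> m \<le> value_bound g V" for g
    by (rule eval_le_value_bound; fact Minus.prems)
  show ?case unfolding compile.simps
  proof (rule runs_within_Seq[OF first], clarify)
    fix r1 assume r1: "r1 d = eval e \<rho> m" "\<forall>i<d. r1 i = r i"
    have "runs_within (compile f \<sigma> (d + 1)) (r1, m) (time_bound f V)
        (\<lambda>(r', m'). m' = m \<and> r' (d + 1) = eval f \<rho> m \<and> (\<forall>i<d + 1. r' i = r1 i))"
      using r1(2) by (intro Minus.IH(2)) (simp_all add: Minus.prems less_SucI)
    then show "runs_within (Seq (compile f \<sigma> (d + 1)) (Sub d d (d + 1))) (r1, m)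
        (time_bound f V + (value_bound e V + value_bound f V + 2))
        (\<lambda>(r', m'). m' = m \<and> r' d = eval (Minus e f) \<rho> m \<and> (\<forall>i<d. r' i = r i))"
    proof (rule runs_within_Seq, clarify)
      fix r2 assume r2: "r2 (d + 1) = eval f \<rho> m" "\<forall>i<d + 1. r2 i = r1 i"
      then show "runs_within (Sub d d (d + 1)) (r2, m) (value_bound e V + value_bound f V + 2)
        (\<lambda>(r', m'). m' = m \<and> r' d = eval (Minus e f) \<rho> m \<and> (\<forall>i<d. r' i = r i))"
        using r1 val[of e] val[of f]
        by (intro runs_within_Sub) auto
    qed simp
  qed simp
next
  case (Cell e)
  have first: "runs_within (compile e \<sigma> d) (r, m) (time_bound e V)
      (\<lambda>(r', m'). m' = m \<and> r' d = eval e \<rho> m \<and> (\<forall>i<d. r' i = r i))"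
    by (rule Cell.IH; fact Cell.prems)
  have val: "eval g \<rho> m \<le> value_bound g V" for g
    by (rule eval_le_value_bound; fact Cell.prems)
  show ?case unfolding compile.simps
  proof (rule runs_within_Seq[OF first], clarify)
    fix r1 assume r1: "r1 d = eval e \<rho> m" "\<forall>i<d. r1 i = r i"
    show "runs_within (Load d d) (r1, m) (value_bound e V + V + 2)
        (\<lambda>(r', m'). m' = m \<and> r' d = eval (Cell e) \<rho> m \<and> (\<forall>i<d. r' i = r i))"
      using r1 val[of e] Cell.prems(4)
      by (intro runs_within_Load) (auto intro: add_mono)
  qed simp
next
  case (SumUp e f)
  let ?k = "eval e \<rho> m" and ?W = "V + value_bound e V"
  \<comment> \<open>In the loop, register \<open>d + 1\<close> holds the bound variable and register
    \<open>d + 2\<close> accumulates the sum, so the summand is evaluated at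
    \<open>d + 3\<close>.\<close>
  let ?part = "\<lambda>i. \<Sum>j<i. eval f (case_nat j \<rho>) m"
  let ?body = "Seq (compile f (case_nat (d + 1) \<sigma>) (d + 3)) (Add (d + 2) (d + 2) (d + 3))"
  let ?J = "\<lambda>i r' m'. m' = m \<and> r' (d + 2) = ?part i \<and> (\<forall>j<d. r' j = r j)"
  let ?T = "time_bound f ?W + value_bound (SumUp e f) V + value_bound f ?W + 2"
  let ?P = "\<lambda>(r', m'). m' = m \<and> r' d = eval (SumUp e f) \<rho> m \<and> (\<forall>i<d. r' i = r i)"
  have val: "eval g \<rho> m \<le> value_bound g V" for g
    by (rule eval_le_value_bound; fact SumUp.prems)
  note k = val[of e]
  have total: "?part ?k \<le> value_bound (SumUp e f) V"
    using val[of "SumUp e f"] by simp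
  \<comment> \<open>Partial sums of natural numbers never exceed the full sum; this bounds the cost
    of every addition to the accumulator.\<close>
  have part: "?part i \<le> value_bound (SumUp e f) V" if "i \<le> ?k" for i
    using that by (intro order_trans[OF _ total] sum_mono2) auto
  have envW: "case_nat i \<rho> j \<le> ?W" if "i < ?k" for i j
    using that k SumUp.prems(3) by (auto split: nat.split intro: trans_le_add1)
  have memW: "m i \<le> ?W" for i using SumUp.prems(4) by (simp add: trans_le_add1)
  have body: "runs_within ?body (r1, m1) ?T
      (\<lambda>(r', m'). ?J (Suc i) r' m' \<and> r' d = r1 d \<and> r' (d + 1) = r1 (d + 1))"
    if i: "i < ?k" "?J i r1 m1" "r1 d = ?k - i" "r1 (d + 1) = i" for i r1 m1
  proof -
    have "runs_within (compile f (case_nat (d + 1) \<sigma>) (d + 3)) (r1, m) (time_bound f ?W)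
      (\<lambda>(r', m'). m' = m \<and> r' (d + 3) = eval f (case_nat i \<rho>) m \<and> (\<forall>i<d + 3. r' i = r1 i))"
    proof (rule SumUp.IH(2))
      fix j
      show "case_nat i \<rho> j \<le> ?W" by (rule envW[OF i(1)])
      show "m j \<le> ?W" by (rule memW)
      show "case_nat (d + 1) \<sigma> j < d + 3"
        using SumUp.prems(1) by (cases j) (simp_all add: trans_less_add1)
      show "r1 (case_nat (d + 1) \<sigma> j) = case_nat i \<rho> j"
        using i SumUp.prems(1,2) by (auto split: nat.split)
    qed
    then have "runs_within ?body (r1, m) ?T
      (\<lambda>(r', m'). ?J (Suc i) r' m' \<and> r' d = r1 d \<and> r' (d + 1) = r1 (d + 1))"
    proof (rule runs_within_Seq, clarify)
      fix r2 assume r2: "r2 (d + 3) = eval f (case_nat i \<rho>) m" "\<forall>i<d + 3. r2 i = r1 i"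
      have "r2 (d + 2) \<le> value_bound (SumUp e f) V" using r2(2) i part[of i] by auto
      moreover have "r2 (d + 3) \<le> value_bound f ?W"
        unfolding r2(1) by (rule eval_le_value_bound) (fact envW[OF i(1)] memW)+
      ultimately show "runs_within (Add (d + 2) (d + 2) (d + 3)) (r2, m)
          (value_bound (SumUp e f) V + value_bound f ?W + 2)
          (\<lambda>(r', m'). ?J (Suc i) r' m' \<and> r' d = r1 d \<and> r' (d + 1) = r1 (d + 1))"
        using r2 i by (intro runs_within_Add) auto
    qed simp
    then show ?thesis using i(2) by simp
  qed
  have first: "runs_within (compile e \<sigma> d) (r, m) (time_bound e V)
      (\<lambda>(r', m'). m' = m \<and> r' d = eval e \<rho> m \<and> (\<forall>i<d. r' i = r i))"
    by (rule SumUp.IH(1); fact SumUp.prems)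
  show ?case unfolding compile.simps
  proof (rule runs_within_Seq[OF first], clarify)
    fix r1 assume r1: "r1 d = eval e \<rho> m" "\<forall>i<d. r1 i = r i"
    have "runs_within (loop d ?body) (r1(d + 2 := 0), m) (loop_time ?k ?T)
        (\<lambda>(r', m'). ?J ?k r' m' \<and> r' d = 0)"
      using r1 by (intro runs_within_loop body) auto
    then have loop: "runs_within (loop d ?body) (r1(d + 2 := 0), m)
        (loop_time (value_bound e V) ?T) (\<lambda>(r', m'). ?J ?k r' m' \<and> r' d = 0)"
      using k by (elim runs_within_weaken) (auto intro: loop_time_mono)
    have "runs_within (Seq (loop d ?body) (Add d d (d + 2))) (r1(d + 2 := 0), m)
        (loop_time (value_bound e V) ?T + (value_bound (SumUp e f) V + 2)) ?P"
    proof (rule runs_within_Seq[OF loop], clarify)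
      \<comment> \<open>The exhausted counter in register \<open>d\<close> is 0, so the final
        addition just copies the sum there.\<close>
      fix r2 assume r2: "r2 (d + 2) = ?part ?k" "\<forall>i<d. r2 i = r i" "r2 d = 0"
      then show "runs_within (Add d d (d + 2)) (r2, m) (value_bound (SumUp e f) V + 2) ?P"
        using total by (intro runs_within_Add) auto
    qed simp
    then show "runs_within (Seq (Const (d + 2) 0) (Seq (loop d ?body) (Add d d (d + 2)))) (r1, m)
       (1 + (loop_time (value_bound e V) ?T + (value_bound (SumUp e f) V + 2))) ?P"
      by (rule runs_within_Const_Seq) simp
  qed simp
qed

definition for_loop :: "expr \<Rightarrow> (nat \<Rightarrow> nat) \<Rightarrow> nat \<Rightarrow> ram \<Rightarrow> ram" where
  "for_loop e \<sigma> d body = Seq (compile e \<sigma> d) (loop d body)"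

text \<open>Here the body may change the memory, so the invariant speaks of the memory, and the
  number of rounds is evaluated once, before the loop.\<close>

lemma runs_within_for_loop:
  assumes env: "\<And>i. \<sigma> i < d" "\<And>i. r (\<sigma> i) = \<rho> i" "\<And>i. \<rho> i \<le> V" "\<And>i. m i \<le> V"
    and k: "eval e \<rho> m = k" and init: "J 0 m"
    and body: "\<And>i r' m'. i < k \<Longrightarrow> J i m' \<Longrightarrow> \<forall>j<d. r' j = r j \<Longrightarrow> r' (d + 1) = i \<Longrightarrow>
      runs_within body (r', m') T (\<lambda>(r'', m''). J (Suc i) m'' \<and> (\<forall>j<d + 2. r'' j = r' j))"
  shows "runs_within (for_loop e \<sigma> d body) (r, m) (time_bound e V + loop_time (value_bound e V) T)
    (\<lambda>(r', m'). J k m' \<and> (\<forall>j<d. r' j = r j))"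
  unfolding for_loop_def
proof (rule runs_within_Seq)
  show "runs_within (compile e \<sigma> d) (r, m) (time_bound e V)
      (\<lambda>(r', m'). m' = m \<and> r' d = eval e \<rho> m \<and> (\<forall>i<d. r' i = r i))"
    by (rule runs_within_compile; fact env)
  fix s assume "case s of (r', m') \<Rightarrow> m' = m \<and> r' d = eval e \<rho> m \<and> (\<forall>i<d. r' i = r i)"
  then obtain r1 where s: "s = (r1, m)" "r1 d = k" "\<forall>i<d. r1 i = r i" using k by auto
  let ?J = "\<lambda>i r' m'. J i m' \<and> (\<forall>j<d. r' j = r j)"
  have "runs_within (loop d body) (r1, m) (loop_time k T) (\<lambda>(r', m'). ?J k r' m' \<and> r' d = 0)"
  proof (rule runs_within_loop[where J = ?J])
    fix i r' m' assume i: "i < k" "?J i r' m'" "r' d = k - i" "r' (d + 1) = i"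
    then have "runs_within body (r', m') T (\<lambda>(r'', m''). J (Suc i) m'' \<and> (\<forall>j<d + 2. r'' j = r' j))"
      using body by blast
    then show "runs_within body (r', m') T
        (\<lambda>(r'', m''). ?J (Suc i) r'' m'' \<and> r'' d = r' d \<and> r'' (d + 1) = r' (d + 1))"
      by (rule runs_within_weaken) (use i(2) in auto)
  qed (use init s in auto)
  then show "runs_within (loop d body) s (loop_time (value_bound e V) T)
      (\<lambda>(r', m'). J k m' \<and> (\<forall>j<d. r' j = r j))"
    unfolding s(1)
  proof (rule runs_within_weaken)
    have "k \<le> value_bound e V" unfolding k[symmetric] by (rule eval_le_value_bound; fact env)
    then show "loop_time k T \<le> loop_time (value_bound e V) T" by (rule loop_time_mono) simp
  qed auto
qed simp

definition write_cell :: "expr \<Rightarrow> expr \<Rightarrow> (nat \<Rightarrow> nat) \<Rightarrow> nat \<Rightarrow> ram" where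
  "write_cell e f \<sigma> d = Seq (compile e \<sigma> d) (Seq (compile f \<sigma> (d + 1)) (Store d (d + 1)))"

definition write_cell_time :: "expr \<Rightarrow> expr \<Rightarrow> nat \<Rightarrow> nat" where
  "write_cell_time e f V = time_bound e V + time_bound f V + value_bound e V + value_bound f V + 2"

lemma runs_within_write_cell:
  assumes env: "\<And>i. \<sigma> i < d" "\<And>i. r (\<sigma> i) = \<rho> i" "\<And>i. \<rho> i \<le> V" "\<And>i. m i \<le> V"
  shows "runs_within (write_cell e f \<sigma> d) (r, m) (write_cell_time e f V)
    (\<lambda>(r', m'). m' = m(eval e \<rho> m := eval f \<rho> m) \<and> (\<forall>j<d. r' j = r j))"
proof -
  let ?P = "\<lambda>(r', m'). m' = m(eval e \<rho> m := eval f \<rho> m) \<and> (\<forall>j<d. r' j = r j)"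
  have val: "eval g \<rho> m \<le> value_bound g V" for g by (rule eval_le_value_bound; fact env)
  have first: "runs_within (compile e \<sigma> d) (r, m) (time_bound e V)
      (\<lambda>(r', m'). m' = m \<and> r' d = eval e \<rho> m \<and> (\<forall>i<d. r' i = r i))"
    by (rule runs_within_compile; fact env)
  show ?thesis unfolding write_cell_def
  proof (rule runs_within_Seq[OF first], clarify)
    fix r1 assume r1: "r1 d = eval e \<rho> m" "\<forall>i<d. r1 i = r i"
    have "runs_within (compile f \<sigma> (d + 1)) (r1, m) (time_bound f V)
        (\<lambda>(r', m'). m' = m \<and> r' (d + 1) = eval f \<rho> m \<and> (\<forall>i<d + 1. r' i = r1 i))"
      using r1(2) by (intro runs_within_compile) (simp_all add: env less_SucI)
    then show "runs_within (Seq (compile f \<sigma> (d + 1)) (Store d (d + 1))) (r1, m)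
        (time_bound f V + (value_bound e V + value_bound f V + 2)) ?P"
    proof (rule runs_within_Seq, clarify)
      fix r2 assume r2: "r2 (d + 1) = eval f \<rho> m" "\<forall>i<d + 1. r2 i = r1 i"
      then show "runs_within (Store d (d + 1)) (r2, m) (value_bound e V + value_bound f V + 2) ?P"
        using r1 val[of e] val[of f] by (intro runs_within_Store) auto
    qed simp
  qed (simp add: write_cell_time_def)
qed

text \<open>Truth values are numbers, 0 being false.\<close>

definition "not_expr e = Minus (Num 1) e"
definition "or_expr e f = Minus (Num 1) (Minus (Num 1) (Plus e f))"
definition "and_expr e f = not_expr (or_expr (not_expr e) (not_expr f))"
definition "le_expr e f = Minus (Num 1) (Minus e f)"
definition "less_expr e f = le_expr (Plus e (Num 1)) f"
definition "eq_expr e f = and_expr (le_expr e f) (le_expr f e)"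
definition "all_expr e f = not_expr (SumUp e (not_expr f))"
definition "ex_expr e f = not_expr (not_expr (SumUp e f))"

lemma eval_not_expr [simp]: "eval (not_expr e) \<rho> m = of_bool (eval e \<rho> m = 0)"
  by (simp add: not_expr_def of_bool_def)

lemma eval_connectives [simp]:
  "eval (or_expr e f) \<rho> m = of_bool (eval e \<rho> m \<noteq> 0 \<or> eval f \<rho> m \<noteq> 0)"
  "eval (and_expr e f) \<rho> m = of_bool (eval e \<rho> m \<noteq> 0 \<and> eval f \<rho> m \<noteq> 0)"
  "eval (le_expr e f) \<rho> m = of_bool (eval e \<rho> m \<le> eval f \<rho> m)"
  "eval (less_expr e f) \<rho> m = of_bool (eval e \<rho> m < eval f \<rho> m)"
  "eval (eq_expr e f) \<rho> m = of_bool (eval e \<rho> m = eval f \<rho> m)"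
  by (auto simp: or_expr_def and_expr_def le_expr_def less_expr_def eq_expr_def of_bool_def)

lemma eval_quantifiers [simp]:
  "eval (all_expr e f) \<rho> m = of_bool (\<forall>i<eval e \<rho> m. eval f (case_nat i \<rho>) m \<noteq> 0)"
  "eval (ex_expr e f) \<rho> m = of_bool (\<exists>i<eval e \<rho> m. eval f (case_nat i \<rho>) m \<noteq> 0)"
  by (simp_all add: all_expr_def ex_expr_def del: sum_of_bool_eq) (auto simp: of_bool_def)

section \<open>The deferred acceptance program\<close>

definition "students_expr = Cell (Num 0)"
definition "schools_expr = Cell (Num 1)"
definition "quota_expr y = Cell (Plus (Num 3) (Var y))"
text \<open>Three sizes and the quotas precede the table. It has one row per student, and each row
  starts with the entry for the outside option, so class \<open>j\<close> is in column
  \<open>j + 1\<close>. The product of row length and row number is a sum with constant summand,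
  under whose binder variable \<open>x\<close> becomes \<open>Suc x\<close>.\<close>

definition "student_pos_expr x e =
  Cell (Plus (Plus (Plus (Num 3) schools_expr) (SumUp (Plus schools_expr (Num 1)) (Var (Suc x)))) e)"
definition "school_pos_expr y e =
  Cell (Plus (Plus (Plus (Plus (Num 3) schools_expr)
    (SumUp students_expr (Plus schools_expr (Num 1))))
    (SumUp (Plus students_expr (Num 1)) (Var (Suc y)))) e)"
text \<open>This is the last table of the input, so it is addressed backwards from the input length,
  held in variable \<open>l\<close>.\<close>

definition "sibling_expr l x x' =
  Cell (Plus (Plus (Minus (Var l) (SumUp students_expr students_expr))
    (SumUp students_expr (Var (Suc x)))) (Var x'))"
definition "current_expr l x = Cell (Plus (Var l) (Var x))"

text \<open>Row and column 0 of the preference tables belong to the outside option.\<close>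

abbreviation "student_pos_of x y \<equiv> student_pos_expr x (Plus (Var y) (Num (Suc 0)))"
abbreviation "student_pos_outside x \<equiv> student_pos_expr x (Num 0)"
abbreviation "school_pos_of y x \<equiv> school_pos_expr y (Plus (Var x) (Num (Suc 0)))"
abbreviation "school_pos_outside y \<equiv> school_pos_expr y (Num 0)"

text \<open>Free variables: 0 is the student, 1 the round counter, 2 the input length. Inside the
  quantifier the class is 0, the student 1 and the length 3; inside the count the competitor is 0,
  the class 1, the student 2 and the length 4.\<close>

definition overdemanded_expr :: expr where
  "overdemanded_expr = ex_expr schools_expr (and_expr
     (eq_expr (student_pos_of 1 0) (current_expr 3 1))
     (or_expr (less_expr (school_pos_outside 0) (school_pos_of 0 1))
        (le_expr (quota_expr 0) (SumUp students_expr (and_expr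
           (le_expr (student_pos_of 0 1) (current_expr 4 0))
           (less_expr (school_pos_of 1 0) (school_pos_of 1 2)))))))"

definition behind_sibling_expr :: expr where
  "behind_sibling_expr = ex_expr students_expr (and_expr
     (or_expr (sibling_expr 3 1 0) (sibling_expr 3 0 1))
     (less_expr (current_expr 3 1) (current_expr 3 0)))"

definition rejected_expr :: expr where
  "rejected_expr = and_expr (less_expr (current_expr 2 0) (student_pos_outside 0))
     (or_expr overdemanded_expr behind_sibling_expr)"

text \<open>It is evaluated where every free variable equals the input length, which therefore has
  index 2 below the two quantifiers.\<close>

definition no_vacancy_expr :: expr where
  "no_vacancy_expr = all_expr students_expr (all_expr schools_expr
     (or_expr
       (not_expr (and_expr (less_expr (student_pos_of 1 0) (current_expr 2 1))
          (less_expr (school_pos_of 0 1) (school_pos_outside 0))))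
       (le_expr (quota_expr 0)
          (SumUp students_expr (eq_expr (student_pos_of 0 1) (current_expr 3 0))))))"

definition siblings_placed_expr :: expr where
  "siblings_placed_expr = all_expr students_expr (all_expr students_expr
     (or_expr (not_expr (sibling_expr 2 1 0))
       (and_expr (less_expr (current_expr 2 1) (student_pos_outside 1))
          (less_expr (current_expr 2 0) (student_pos_outside 0)))))"

definition answer_expr :: expr where
  "answer_expr = and_expr no_vacancy_expr siblings_placed_expr"

text \<open>Positions are at most the number of classes, so their sum over all students stays below
  this value.\<close>

definition rounds_expr :: expr where
  "rounds_expr = Plus (Num 1) (SumUp students_expr (Plus schools_expr (Num 1)))"

definition address_expr :: expr where
  "address_expr = Plus (Var 2) (Var 0)"

definition update_expr :: expr where
  "update_expr = Plus (current_expr 2 0) rejected_expr"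

text \<open>
  Register 0 holds the input length \<open>L\<close>; cell \<open>L + i\<close> holds the current position of the
  \<open>i\<close>-th student, which is 0 at the start.
\<close>

abbreviation (input) outer_env :: "nat \<Rightarrow> nat" where
  "outer_env \<equiv> case_nat 2 (\<lambda>_. 0)"

abbreviation (input) inner_env :: "nat \<Rightarrow> nat" where
  "inner_env \<equiv> case_nat 4 outer_env"

text \<open>A loop based at \<open>d\<close> keeps its counters in \<open>d\<close> and
  \<open>d + 1\<close>: the rounds use registers 1 and 2, the students 3 and 4, and updates are
  computed from 5 on. Register 0 keeps the input length until the answer is copied into it.\<close>

definition deferred_acceptance :: ram where
  "deferred_acceptance =
     Seq (for_loop rounds_expr (\<lambda>_. 0) 1
       (for_loop students_expr outer_env 3 (write_cell address_expr update_expr inner_env 5)))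
     (Seq (compile answer_expr (\<lambda>_. 0) 1) (Seq (Const 2 0) (Add 0 1 2)))"

definition sweep_time :: "nat \<Rightarrow> nat" where
  "sweep_time V = time_bound students_expr V +
     loop_time (value_bound students_expr V) (write_cell_time address_expr update_expr V)"

definition total_time :: "nat \<Rightarrow> nat" where
  "total_time V = time_bound rounds_expr V + loop_time (value_bound rounds_expr V) (sweep_time V) +
     time_bound answer_expr V + value_bound answer_expr V + 3"

lemma poly_bounded_total_time: "poly_bounded total_time"
proof -
  have "poly_bounded (\<lambda>V. total_time V)"
    by (simp add: total_time_def sweep_time_def write_cell_time_def poly_bounded_intros
        poly_bounded_loop_time poly_bounded_time_bound poly_bounded_value_bound)
  then show ?thesis by simp
qed

section \<open>Correctness of the program\<close>

lemma length_concat_rows: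
  "(\<And>x. x \<in> set xs \<Longrightarrow> length (f x) = k) \<Longrightarrow> length (concat (map f xs)) = k * length xs"
  by (induction xs) auto

lemma nth_concat_rows:
  assumes "\<And>x. x \<in> set xs \<Longrightarrow> length (f x) = k" "i < length xs" "j < k"
  shows "concat (map f xs) ! (k * i + j) = f (xs ! i) ! j"
  using assms
proof (induction xs arbitrary: i)
  case (Cons x xs)
  show ?case
  proof (cases i)
    case (Suc i')
    then have "concat (map f xs) ! (k * i' + j) = f (xs ! i') ! j" using Cons by simp
    then show ?thesis using Suc Cons.prems(1)[of x] by (simp add: nth_append algebra_simps)
  qed (use Cons.prems in \<open>simp add: nth_append\<close>)
qed simp

text \<open>Every entry costs at least one digit. Times are first estimated by the length of the
  input; this carries them over to its size.\<close>

lemma le_input_size: "length w \<le> input_size w"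
proof -
  have "Suc n \<le> digits x + k" if "n \<le> k" for n x k
    using that by (simp add: digits_def)
  then show ?thesis unfolding input_size_def by (induction w) simp_all
qed

section \<open>Memory layout of an encoded instance\<close>

locale encoded_mssp = mssp_positions I for I :: "('a, 'b, 'c) mssp" +
  fixes as :: "'a list" and bs :: "'b list" and cs :: "'c list"
  assumes as: "distinct as" "set as = students I"
    and bs: "distinct bs" "set bs = schools I"
    and cs: "distinct cs" "set cs = activities I"
begin

definition "w = encode_mssp I as bs cs"

abbreviation "na \<equiv> length as"
abbreviation "nb \<equiv> length bs"
abbreviation "L \<equiv> length w"

definition "student_table = concat (map (\<lambda>a. map (pos a) (None # map Some bs)) as)"
definition "school_table = concat (map (\<lambda>b. map (spos b) (None # map Some as)) bs)"
definition activity_table :: "nat list" where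
  "activity_table = concat (map (\<lambda>c. map (\<lambda>b. of_bool (b \<in> activity_classes I c)) bs) cs)"
definition sibling_table :: "nat list" where
  "sibling_table = concat (map (\<lambda>a. map (\<lambda>a'. of_bool ((a, a') \<in> siblings I)) as) as)"

lemma length_tables:
  "length student_table = Suc nb * na" "length school_table = Suc na * nb"
  "length activity_table = nb * length cs" "length sibling_table = na * na"
  unfolding student_table_def school_table_def activity_table_def sibling_table_def
  by (rule length_concat_rows, simp)+

lemma w_eq: "w = [na, nb, length cs] @ map (quota I) bs @ student_table @ school_table @
    activity_table @ sibling_table"
  by (simp add: w_def encode_mssp_def student_table_def school_table_def activity_table_def
      sibling_table_def)

lemma L_eq: "L = 3 + nb + Suc nb * na + Suc na * nb + nb * length cs + na * na"
  by (simp add: w_eq length_tables)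

lemma nth_w:
  "w ! 0 = na" "w ! 1 = nb"
  "j < nb \<Longrightarrow> w ! (3 + j) = map (quota I) bs ! j"
  "j < Suc nb * na \<Longrightarrow> w ! (3 + nb + j) = student_table ! j"
  "j < Suc na * nb \<Longrightarrow> w ! (3 + nb + na * Suc nb + j) = school_table ! j"
  "j < na * na \<Longrightarrow> w ! (L - na * na + j) = sibling_table ! j"
proof -
  show "w ! 0 = na" "w ! 1 = nb" by (simp_all add: w_eq)
  show "w ! (3 + j) = map (quota I) bs ! j" if "j < nb"
    using that by (simp add: w_eq nth_append)
  show "w ! (3 + nb + j) = student_table ! j" if "j < Suc nb * na"
  proof -
    let ?pre = "[na, nb, length cs] @ map (quota I) bs"
    have "w = ?pre @ student_table @ (school_table @ activity_table @ sibling_table)" by (simp add: w_eq)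
    moreover have "3 + nb + j = length ?pre + j" by simp
    ultimately show ?thesis using that
      by (simp only: nth_append_length_plus nth_append length_tables) simp
  qed
  show "w ! (3 + nb + na * Suc nb + j) = school_table ! j" if "j < Suc na * nb"
  proof -
    let ?pre = "[na, nb, length cs] @ map (quota I) bs @ student_table"
    have "w = ?pre @ school_table @ (activity_table @ sibling_table)" by (simp add: w_eq)
    moreover have "3 + nb + na * Suc nb + j = length ?pre + j" by (simp add: length_tables)
    ultimately show ?thesis using that
      by (simp only: nth_append_length_plus nth_append length_tables) simp
  qed
  show "w ! (L - na * na + j) = sibling_table ! j" if "j < na * na"
  proof -
    let ?pre = "[na, nb, length cs] @ map (quota I) bs @ student_table @ school_table @ activity_table"
    have "w = ?pre @ sibling_table" by (simp add: w_eq)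
    moreover have "L - na * na = length ?pre" by (simp add: L_eq length_tables)
    ultimately show ?thesis by (metis nth_append_length_plus)
  qed
qed

lemma index_less: "i < k \<Longrightarrow> j < n \<Longrightarrow> n * i + j < n * (k :: nat)"
proof -
  assume "i < k" "j < n"
  then have "n * i + j < n * Suc i" by simp
  also have "\<dots> \<le> n * k" using \<open>i < k\<close> by (intro mult_le_mono2) simp
  finally show ?thesis .
qed

text \<open>The input is never overwritten, so the vector determines the whole memory, and loop
  invariants reduce to statements about vectors.\<close>

definition memory :: "('a \<Rightarrow> nat) \<Rightarrow> nat \<Rightarrow> nat" where
  "memory c i = (if i < L then w ! i else if i < L + na then c (as ! (i - L)) else 0)"

lemma memory_input: "i < L \<Longrightarrow> memory c i = w ! i"
  by (simp add: memory_def)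

lemma memory_current: "i < na \<Longrightarrow> memory c (L + i) = c (as ! i)"
  by (simp add: memory_def)

lemma memory_students: "memory c 0 = na"
  and memory_schools: "memory c (Suc 0) = nb"
  using nth_w(1,2) by (simp_all add: memory_def L_eq)

lemma memory_quota: "j < nb \<Longrightarrow> memory c (3 + j) = quota I (bs ! j)"
  using nth_w(3)[of j] by (simp add: memory_def L_eq)

lemma memory_student_pos:
  assumes "i < na" "j < Suc nb"
  shows "memory c (3 + nb + Suc nb * i + j) = pos (as ! i) ((None # map Some bs) ! j)"
proof -
  have less: "Suc nb * i + j < Suc nb * na" using assms by (rule index_less)
  have "student_table ! (Suc nb * i + j) = map (pos (as ! i)) (None # map Some bs) ! j"
    unfolding student_table_def using assms by (intro nth_concat_rows) auto
  also have "\<dots> = pos (as ! i) ((None # map Some bs) ! j)" using assms by (intro nth_map) simp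
  finally show ?thesis
    using nth_w(4)[OF less] memory_input[of "3 + nb + (Suc nb * i + j)"] less L_eq
    by (simp add: algebra_simps)
qed

lemma memory_school_pos:
  assumes "j < nb" "i < Suc na"
  shows "memory c (3 + nb + na * Suc nb + Suc na * j + i) = spos (bs ! j) ((None # map Some as) ! i)"
proof -
  have less: "Suc na * j + i < Suc na * nb" using assms by (rule index_less)
  have "school_table ! (Suc na * j + i) = map (spos (bs ! j)) (None # map Some as) ! i"
    unfolding school_table_def using assms by (intro nth_concat_rows) auto
  also have "\<dots> = spos (bs ! j) ((None # map Some as) ! i)" using assms by (intro nth_map) simp
  finally show ?thesis
    using nth_w(5)[OF less] memory_input[of "3 + nb + na * Suc nb + (Suc na * j + i)"] less L_eq
    by (simp add: algebra_simps)
qed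

lemma memory_sibling:
  assumes "i < na" "i' < na"
  shows "memory c (L - na * na + na * i + i') = of_bool ((as ! i, as ! i') \<in> siblings I)"
proof -
  have less: "na * i + i' < na * na" using assms by (rule index_less)
  have "sibling_table ! (na * i + i') = map (\<lambda>a'. of_bool ((as ! i, a') \<in> siblings I)) as ! i'"
    unfolding sibling_table_def using assms by (intro nth_concat_rows) auto
  moreover have "L - na * na + (na * i + i') < L" using less L_eq by linarith
  ultimately show ?thesis
    using nth_w(6)[OF less] assms by (simp add: memory_def add.assoc)
qed

lemma pos_le: "a \<in> students I \<Longrightarrow> y \<in> with_outside (schools I) \<Longrightarrow> pos a y \<le> nb"
  and spos_le: "b \<in> schools I \<Longrightarrow> x \<in> with_outside (students I) \<Longrightarrow> spos b x \<le> na"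
proof -
  have card: "card (with_outside (set xs)) = Suc (length xs)" if "distinct xs" for xs :: "'d list"
    using that by (simp add: with_outside_def card_insert_if image_iff card_image distinct_card)
  show "pos a y \<le> nb" if "a \<in> students I" "y \<in> with_outside (schools I)"
  proof -
    have "pos a y \<in> pos a ` with_outside (schools I)" using that(2) by simp
    then show ?thesis
      using pref_position_image[OF student_order[OF that(1)]] card[OF bs(1)] bs(2) by simp
  qed
  show "spos b x \<le> na" if "b \<in> schools I" "x \<in> with_outside (students I)"
  proof -
    have "spos b x \<in> spos b ` with_outside (students I)" using that(2) by simp
    then show ?thesis
      using pref_position_image[OF school_order[OF that(1)]] card[OF as(1)] as(2) by simp
  qed
qed

text \<open>The number of activities is itself an entry of the input and must not exceed its length.
  Without classes there are no activities, as each one has a class; otherwise the activity table is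
  large enough.\<close>

lemma activities_le: "length cs \<le> nb * length cs"
proof (cases "nb = 0")
  case True
  then have "(\<Union>c\<in>activities I. activity_classes I c) = {}" "\<forall>c\<in>activities I. activity_classes I c \<noteq> {}"
    using bs mssp by (auto simp: mssp_instance_def)
  then have "activities I = {}" by auto
  then show ?thesis using cs by simp
next
  case False
  then show ?thesis by (cases nb) auto
qed

text \<open>Encoding preferences by positions and bounding quotas by the number of students keeps
  all entries small. This makes \<open>L\<close> a valid \<open>V\<close> in the estimates of values
  and times.\<close>

lemma w_le: "x \<in> set w \<Longrightarrow> x \<le> L"
proof -
  assume x: "x \<in> set w"
  have "quota I b \<le> na" if "b \<in> schools I" for b
    using that mssp distinct_card[OF as(1)] as(2)
    by (simp add: mssp_instance_def school_matching_instance_def)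
  then have "x \<le> na \<or> x \<le> nb \<or> x \<le> length cs \<or> x \<le> 1"
    using x as(2) bs(2) pos_le spos_le
    by (auto simp: w_eq student_table_def school_table_def activity_table_def sibling_table_def)
  moreover have "length cs \<le> L"
    by (rule order_trans[OF activities_le]) (simp add: L_eq)
  moreover have "na \<le> L" "nb \<le> L" "1 \<le> L" by (simp_all add: L_eq)
  ultimately show ?thesis by auto
qed

lemma memory_le:
  assumes "\<And>a. a \<in> students I \<Longrightarrow> c a \<le> pos a None"
  shows "memory c i \<le> L"
proof -
  have "c a \<le> L" if "a \<in> students I" for a
    using assms[OF that] pos_le[OF that, of None] L_eq by simp
  moreover have "as ! (i - L) \<in> students I" if "i < L + na" "\<not> i < L"
    using that unfolding as(2)[symmetric] by (intro nth_mem) simp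
  ultimately show ?thesis using w_le by (auto simp: memory_def)
qed

text \<open>As \<open>as\<close> has no repetitions, the overwritten cell belongs to no other
  student.\<close>

lemma memory_update:
  "i < na \<Longrightarrow> (memory c)(L + i := v) = memory (c(as ! i := v))"
  using as(1) by (auto simp: memory_def fun_eq_iff nth_eq_iff_index_eq)

section \<open>Values of the expressions on the memory\<close>

lemma eval_sizes [simp]:
  "eval students_expr \<rho> (memory c) = na" "eval schools_expr \<rho> (memory c) = nb"
  by (simp_all add: students_expr_def schools_expr_def memory_students memory_schools)

lemma eval_current [simp]:
  "\<rho> l = L \<Longrightarrow> \<rho> x < na \<Longrightarrow> eval (current_expr l x) \<rho> (memory c) = c (as ! \<rho> x)"
  by (simp add: current_expr_def memory_current)

lemma eval_quota [simp]:
  "\<rho> y < nb \<Longrightarrow> eval (quota_expr y) \<rho> (memory c) = quota I (bs ! \<rho> y)"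
  by (simp add: quota_expr_def memory_quota)

lemma eval_student_pos [simp]:
  "\<rho> x < na \<Longrightarrow> \<rho> y < nb \<Longrightarrow>
    eval (student_pos_of x y) \<rho> (memory c) = pos (as ! \<rho> x) (Some (bs ! \<rho> y))"
  "\<rho> x < na \<Longrightarrow> eval (student_pos_outside x) \<rho> (memory c) = pos (as ! \<rho> x) None"
  using memory_student_pos[of "\<rho> x" "Suc (\<rho> y)" c] memory_student_pos[of "\<rho> x" 0 c]
  by (simp_all add: student_pos_expr_def)

lemma eval_school_pos [simp]:
  "\<rho> y < nb \<Longrightarrow> \<rho> x < na \<Longrightarrow>
    eval (school_pos_of y x) \<rho> (memory c) = spos (bs ! \<rho> y) (Some (as ! \<rho> x))"
  "\<rho> y < nb \<Longrightarrow> eval (school_pos_outside y) \<rho> (memory c) = spos (bs ! \<rho> y) None"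
  using memory_school_pos[of "\<rho> y" "Suc (\<rho> x)" c] memory_school_pos[of "\<rho> y" 0 c]
  by (simp_all add: school_pos_expr_def)

lemma eval_sibling [simp]:
  "\<rho> l = L \<Longrightarrow> \<rho> x < na \<Longrightarrow> \<rho> x' < na \<Longrightarrow>
    eval (sibling_expr l x x') \<rho> (memory c) = of_bool ((as ! \<rho> x, as ! \<rho> x') \<in> siblings I)"
  using memory_sibling[of "\<rho> x" "\<rho> x'" c] by (simp add: sibling_expr_def)

lemma ex_index:
  "(\<exists>i<na. R (as ! i)) \<longleftrightarrow> (\<exists>a\<in>students I. R a)" "(\<exists>j<nb. R' (bs ! j)) \<longleftrightarrow> (\<exists>b\<in>schools I. R' b)"
    unfolding as(2)[symmetric] bs(2)[symmetric] by (auto simp: Bex_def in_set_conv_nth)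

lemma all_index2:
  "(\<forall>i<na. \<forall>j<nb. R (as ! i) (bs ! j)) \<longleftrightarrow> (\<forall>a\<in>students I. \<forall>b\<in>schools I. R a b)"
  "(\<forall>i<na. \<forall>i'<na. R' (as ! i) (as ! i')) \<longleftrightarrow> (\<forall>a\<in>students I. \<forall>a'\<in>students I. R' a a')"
  unfolding as(2)[symmetric] bs(2)[symmetric] by (auto simp: Ball_def in_set_conv_nth)

lemma count_index: "(\<Sum>i<na. of_bool (R (as ! i))) = card {a\<in>students I. R a}"
proof -
  have "(\<Sum>i<na. of_bool (R (as ! i))) = (\<Sum>a\<in>students I. of_bool (R a) :: nat)"
    by (rule sum.reindex_bij_betw[OF bij_betw_nth]) (use as in auto)
  also have "\<dots> = card {a\<in>students I. R a}" by (simp add: Int_def)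
  finally show ?thesis .
qed

lemma eval_rejected:
  assumes i: "i < na"
  shows "eval rejected_expr (case_nat i (case_nat t (\<lambda>_. L))) (memory c) = of_bool (rejected c (as ! i))"
proof -
  let ?\<rho> = "case_nat i (case_nat t (\<lambda>_. L))"
  have "eval overdemanded_expr ?\<rho> (memory c) = of_bool (\<exists>j<nb. pos (as ! i) (Some (bs ! j)) = c (as ! i) \<and>
      (spos (bs ! j) None < spos (bs ! j) (Some (as ! i)) \<or>
       quota I (bs ! j) \<le> (\<Sum>i'<na. of_bool (pos (as ! i') (Some (bs ! j)) \<le> c (as ! i') \<and>
         spos (bs ! j) (Some (as ! i')) < spos (bs ! j) (Some (as ! i))))))"
    unfolding overdemanded_expr_def using i
    by (simp del: sum_of_bool_eq cong: conj_cong sum.cong_simp)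
  moreover have "eval behind_sibling_expr ?\<rho> (memory c) = of_bool (\<exists>i'<na.
      ((as ! i, as ! i') \<in> siblings I \<or> (as ! i', as ! i) \<in> siblings I) \<and> c (as ! i) < c (as ! i'))"
    unfolding behind_sibling_expr_def using i by (simp cong: conj_cong)
  ultimately show ?thesis
    unfolding rejected_expr_def rejected_def
      count_index[of "\<lambda>a. pos a (Some b) \<le> c a \<and> spos b (Some a) < spos b (Some (as ! i))" for b]
      ex_index(2)[of "\<lambda>b. pos (as ! i) (Some b) = c (as ! i) \<and>
        (spos b None < spos b (Some (as ! i)) \<or> quota I b \<le> card {a\<in>students I. pos a (Some b) \<le> c a \<and>
           spos b (Some a) < spos b (Some (as ! i))})"]
      ex_index(1)[of "\<lambda>a. ((as ! i, a) \<in> siblings I \<or> (a, as ! i) \<in> siblings I) \<and> c (as ! i) < c a"]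
    using i by simp
qed

lemma eval_answer: "eval answer_expr (\<lambda>_. L) (memory c) = of_bool (accepting c)"
proof -
  have "eval no_vacancy_expr (\<lambda>_. L) (memory c) = of_bool (\<forall>i<na. \<forall>j<nb.
      \<not> (pos (as ! i) (Some (bs ! j)) < c (as ! i) \<and> spos (bs ! j) (Some (as ! i)) < spos (bs ! j) None) \<or>
      quota I (bs ! j) \<le> (\<Sum>i'<na. of_bool (pos (as ! i') (Some (bs ! j)) = c (as ! i'))))"
    unfolding no_vacancy_expr_def by (simp del: sum_of_bool_eq cong: conj_cong sum.cong_simp) blast
  moreover have "eval siblings_placed_expr (\<lambda>_. L) (memory c) = of_bool (\<forall>i<na. \<forall>i'<na.
      (as ! i, as ! i') \<notin> siblings I \<or> c (as ! i) < pos (as ! i) None \<and> c (as ! i') < pos (as ! i') None)"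
    unfolding siblings_placed_expr_def by (simp cong: conj_cong) blast
  ultimately show ?thesis
    unfolding answer_expr_def accepting_def seats_def
      count_index[of "\<lambda>a. pos a (Some b) = c a" for b]
      all_index2(1)[of "\<lambda>a b. \<not> (pos a (Some b) < c a \<and> spos b (Some a) < spos b None) \<or>
        quota I b \<le> card {a\<in>students I. pos a (Some b) = c a}"]
      all_index2(2)[of "\<lambda>a a'. (a, a') \<notin> siblings I \<or> c a < pos a None \<and> c a' < pos a' None"]
    by auto
qed

section \<open>Execution of the program\<close>

lemma runs_within_sweep:
  assumes r: "r 0 = L" "r 2 = t" and t: "t \<le> L" and lb: "lower_bound c"
  shows "runs_within (for_loop students_expr outer_env 3 (write_cell address_expr update_expr inner_env 5))
    (r, memory c) (sweep_time L) (\<lambda>(r', m'). m' = memory (sweep as c) \<and> (\<forall>j<3. r' j = r j))"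
proof -
  have na_le: "na \<le> L" by (simp add: L_eq)
  \<comment> \<open>After \<open>i\<close> writes the memory represents a sweep over the first
    \<open>i\<close> students. Such partial sweeps are still lower bounds, which keeps every cell at
    or below \<open>L\<close> throughout.\<close>
  let ?c = "\<lambda>i. sweep (take i as) c"
  have lb': "lower_bound (?c i)" for i
    by (rule lower_bound_sweep[OF lb]) (use as(2) set_take_subset in fast)
  then have mem_le: "memory (?c i) x \<le> L" for i x
    by (intro memory_le) (simp add: lower_bound_def)
  have "runs_within (for_loop students_expr outer_env 3 (write_cell address_expr update_expr inner_env 5))
    (r, memory c) (time_bound students_expr L +
      loop_time (value_bound students_expr L) (write_cell_time address_expr update_expr L))
    (\<lambda>(r', m'). m' = memory (?c na) \<and> (\<forall>j<3. r' j = r j))"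
  proof (rule runs_within_for_loop[where \<rho> = "case_nat t (\<lambda>_. L)" and J = "\<lambda>i m'. m' = memory (?c i)"])
    fix i
    show "outer_env i < 3" "r (outer_env i) = case_nat t (\<lambda>_. L) i" "case_nat t (\<lambda>_. L) i \<le> L"
      using r t by (cases i; simp)+
    show "memory c i \<le> L" using mem_le[of 0 i] by (simp add: sweep_def)
  next
    show "memory c = memory (?c 0)" by (simp add: sweep_def)
  next
    fix i r1 m1 assume i: "i < na" and m1: "m1 = memory (?c i)"
      and r1: "\<forall>j<3. r1 j = r j" "r1 (3 + 1) = i"
    let ?\<rho> = "case_nat i (case_nat t (\<lambda>_. L))"
    have "runs_within (write_cell address_expr update_expr inner_env 5) (r1, memory (?c i))
        (write_cell_time address_expr update_expr L)
        (\<lambda>(r', m'). m' = (memory (?c i))(eval address_expr ?\<rho> (memory (?c i)) :=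
            eval update_expr ?\<rho> (memory (?c i))) \<and> (\<forall>j<5. r' j = r1 j))"
    proof (rule runs_within_write_cell)
      fix x
      show "inner_env x < 5" by (auto split: nat.split)
      show "r1 (inner_env x) = ?\<rho> x" using r r1 by (auto split: nat.split)
      show "?\<rho> x \<le> L" using i na_le t by (auto split: nat.split)
      show "memory (?c i) x \<le> L" by (rule mem_le)
    qed
    moreover have "(memory (?c i))(eval address_expr ?\<rho> (memory (?c i)) :=
        eval update_expr ?\<rho> (memory (?c i))) = memory (?c (Suc i))"
      using i by (simp add: address_expr_def update_expr_def eval_rejected memory_update
          sweep_def take_Suc_conv_app_nth reject_step_def)
    ultimately show "runs_within (write_cell address_expr update_expr inner_env 5) (r1, m1)
        (write_cell_time address_expr update_expr L)
        (\<lambda>(r'', m''). m'' = memory (?c (Suc i)) \<and> (\<forall>j<3 + 2. r'' j = r1 j))"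
      by (simp add: m1)
  qed simp
  then show ?thesis by (simp add: sweep_time_def)
qed

text \<open>The round index is a variable for the expressions in the inner loop, so it has to
  respect the bound \<open>L\<close> on variables.\<close>

lemma rounds_le: "1 + na * (nb + 1) \<le> L"
  by (simp add: L_eq algebra_simps)

text \<open>Blank cells read 0, so the starting vector is in place without any
  initialisation.\<close>

lemma initial_memory: "initial_state w = ((\<lambda>_. 0)(0 := L), memory (\<lambda>_. 0))"
  by (auto simp: initial_state_def memory_def)

lemma deferred_acceptance_correct:
  "runs_within deferred_acceptance (initial_state w) (total_time L)
    (\<lambda>(r, m). r 0 = of_bool (\<exists>M. activity_stable I M))"
proof -
  define k where "k = 1 + na * (nb + 1)"
  let ?c = "\<lambda>i. (sweep as ^^ i) (\<lambda>_. 0)"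
  let ?r = "(\<lambda>_::nat. 0 :: nat)(0 := L)"
  have lb: "lower_bound (?c i)" for i
    by (rule lower_bound_sweeps[OF lower_bound_zero]) (simp add: as)
  then have mem_le: "memory (?c i) x \<le> L" for i x
    by (intro memory_le) (simp add: lower_bound_def)
  have "sum (\<lambda>a. pos a None) (students I) \<le> (\<Sum>a\<in>students I. nb)"
    by (intro sum_mono pos_le) auto
  also have "\<dots> < k" using as distinct_card[OF as(1)] by (simp add: k_def)
  finally have "\<forall>a\<in>students I. \<not> rejected (?c k) a"
    by (rule sweeps_fixpoint[OF as(2) lower_bound_zero])
  then have answer: "accepting (?c k) \<longleftrightarrow> (\<exists>M. activity_stable I M)"
    using accepting_iff_solvable[OF lb] activity_stable_solvable_iff by blast
  have loop: "runs_within (for_loop rounds_expr (\<lambda>_. 0) 1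
       (for_loop students_expr outer_env 3 (write_cell address_expr update_expr inner_env 5)))
     (?r, memory (\<lambda>_. 0)) (time_bound rounds_expr L + loop_time (value_bound rounds_expr L) (sweep_time L))
     (\<lambda>(r', m'). m' = memory (?c k) \<and> (\<forall>j<1. r' j = ?r j))"
  proof (rule runs_within_for_loop[where \<rho> = "\<lambda>_. L" and J = "\<lambda>i m'. m' = memory (?c i)"])
    show "memory (\<lambda>_. 0) i \<le> L" for i using mem_le[of 0 i] by simp
    show "eval rounds_expr (\<lambda>_. L) (memory (\<lambda>_. 0)) = k" by (simp add: rounds_expr_def k_def)
    fix i r1 m1 assume i: "i < k" and m1: "m1 = memory (?c i)"
      and r1: "\<forall>j<1. r1 j = ?r j" "r1 (1 + 1) = i"
    have "i \<le> L" using i rounds_le by (simp add: k_def)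
    then show "runs_within (for_loop students_expr outer_env 3
          (write_cell address_expr update_expr inner_env 5)) (r1, m1) (sweep_time L)
        (\<lambda>(r'', m''). m'' = memory (?c (Suc i)) \<and> (\<forall>j<1 + 2. r'' j = r1 j))"
      using runs_within_sweep[of r1 i "?c i"] lb r1 m1 by (simp add: numeral_2_eq_2 numeral_3_eq_3)
  qed simp_all
  show ?thesis
    unfolding deferred_acceptance_def initial_memory
  proof (rule runs_within_Seq[OF loop], clarify)
    fix r1 assume "\<forall>j<1. r1 j = ?r j"
    then have r1: "r1 0 = L" by simp
    have "runs_within (compile answer_expr (\<lambda>_. 0) 1) (r1, memory (?c k)) (time_bound answer_expr L)
      (\<lambda>(r', m'). m' = memory (?c k) \<and> r' 1 = eval answer_expr (\<lambda>_. L) (memory (?c k)) \<and>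
        (\<forall>i<1. r' i = r1 i))"
      by (rule runs_within_compile) (simp_all add: r1 mem_le)
    then show "runs_within (Seq (compile answer_expr (\<lambda>_. 0) 1) (Seq (Const 2 0) (Add 0 1 2)))
        (r1, memory (?c k)) (time_bound answer_expr L + (value_bound answer_expr L + 3))
        (\<lambda>(r, m). r 0 = of_bool (\<exists>M. activity_stable I M))"
    proof (rule runs_within_Seq, clarify)
      fix r2 :: "nat \<Rightarrow> nat"
      assume r2: "r2 1 = eval answer_expr (\<lambda>_. L) (memory (?c k))"
      have "r2 1 \<le> value_bound answer_expr L"
        unfolding r2 by (rule eval_le_value_bound) (simp_all add: mem_le)
      then show "runs_within (Seq (Const 2 0) (Add 0 1 2)) (r2, memory (?c k))
          (value_bound answer_expr L + 3) (\<lambda>(r, m). r 0 = of_bool (\<exists>M. activity_stable I M))"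
        by (intro runs_within_Const_Seq[where T = "value_bound answer_expr L + 2"] runs_within_Add)
          (use r2 eval_answer answer in simp_all)
    qed simp
  qed (simp add: total_time_def)
qed

end

theorem theorem6:
  shows "decidable_in_polynomial_time mssp_encoding
           {I :: (nat, nat, nat) mssp. mssp_instance I}
           (\<lambda>I. \<exists>M. activity_stable I M)"
proof -
  obtain f :: "nat poly" where f: "\<And>x. total_time x \<le> poly f x"
    using poly_bounded_total_time unfolding poly_bounded_def by blast
  show ?thesis
    unfolding decidable_in_polynomial_time_def
  proof (intro exI[of _ deferred_acceptance] exI[of _ f] ballI allI impI)
    fix I :: "(nat, nat, nat) mssp" and w
    assume I: "I \<in> {I. mssp_instance I}" and w: "mssp_encoding I w"
    then obtain as bs cs where enc: "distinct as" "set as = students I" "distinct bs"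
      "set bs = schools I" "distinct cs" "set cs = activities I" "w = encode_mssp I as bs cs"
      unfolding mssp_encoding_def by blast
    \<comment> \<open>Only the correctness argument depends on the enumerations; program and
      polynomial are already fixed.\<close>
    interpret encoded_mssp I as bs cs
      by unfold_locales (use I enc in auto)
    have w_eq: "w = local.w" by (simp add: enc w_def)
    have "total_time (length w) \<le> poly f (input_size w)"
      using f poly_mono_nat[OF le_input_size] by (rule order_trans)
    with deferred_acceptance_correct
    have "runs_within deferred_acceptance (initial_state w) (poly f (input_size w))
        (\<lambda>(r, m). r 0 = of_bool (\<exists>M. activity_stable I M))"
      unfolding w_eq by (rule runs_within_weaken) auto
    then show "\<exists>t r m. exec deferred_acceptance (initial_state w) t (r, m) \<and>
        t \<le> poly f (input_size w) \<and> r 0 = (if \<exists>M. activity_stable I M then 1 else 0)"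
      unfolding runs_within_def by (fastforce simp: of_bool_def)
  qed
qed

end
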